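(* Let $\rho\in\mathcal P^-$ and let $\tilde\rho=\rho+(1-\|\rho\|)\delta_\omega$, a probability measure on $X$. Then $$\overline C(\rho)=\sup\left\{\int_X u\,d\tilde\rho\ :\ \frac1N\sum_{i=1}^N u(x_i)\le\tilde c(x_1,\dots,x_N)\ \text{ for }\tilde\rho^{\otimes N}\text{-a.e. }(x_1,\dots,x_N)\in X^N\right\},$$ where the equality holds both when the supremum is taken over $u\in\mathcal S(X)$ and when it is taken over $u\in C(X)$.
   Context: Let $d\ge1$ and $N\ge 2$ be integers. $\mathcal P$ is the set of Borel probability measures on $\mathbb R^d$; $\mathcal P^-$ is the set of nonnegative Borel measures $\rho$ on $\mathbb R^d$ with total mass $\|\rho\|=\rho(\mathbb R^d)\le 1$. $\rho_n\stackrel{*}{\rightharpoonup}\rho$ denotes weak* convergence in duality with the continuous functions on $\mathbb R^d$ vanishing at infinity. Let $c(x_1,\dots,x_N)=\sum_{1\le i<j\le N}\frac1{|x_i-x_j|}$ for $x_i\in\mathbb R^d$ (with $1/0=+\infty$). For $\rho\in\mathcal P$, $C(\rho)=\inf\{\int c\,dP : P \text{ Borel probability on }(\mathbb R^d)^N \text{ with all } N \text{ marginals equal to } \rho\}$. For $\rho\in\mathcal P^-$, $\overline C(\rho)=\inf\{\liminf_n C(\rho_n) : \rho_n\in\mathcal P,\ \rho_n\stackrel{*}{\rightharpoonup}\rho\}$. $X=\mathbb R^d\cup\{\omega\}$ is the Alexandroff (one-point) compactification of $\mathbb R^d$; measures on $\mathbb R^d$ are viewed as measures on $X$. On $X^N$,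 $\tilde c(x_1,\dots,x_N)=\sum_{1\le i<j\le N}\frac1{|x_i-x_j|}$ with the convention $1/|a-b|=0$ whenever $a$ or $b$ equals $\omega$. $C(X)$ is the set of continuous functions $X\to\mathbb R$ and $\mathcal S(X)$ the set of lower semicontinuous functions $X\to\mathbb R$. *)

theory Defs
  imports "HOL-Probability.Probability"
begin

text \<open>
  \<open>\<real>\<^sup>d\<close> is \<^typ>\<open>real ^ 'd\<close>.  An \<open>N\<close>-tuple is a function on the index set
  \<open>{..<N}\<close>, so indices run from \<open>0\<close> to \<open>N - 1\<close>, and \<open>(\<real>\<^sup>d)\<^sup>N\<close> is the
  product measurable space, whose sigma-algebra is the Borel one by second countability.
\<close>

definition borel_probs :: "'a::topological_space measure set" where
  "borel_probs = {\<rho>. sets \<rho> = sets borel \<and> prob_space \<rho>}"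

definition borel_subprobs :: "'a::topological_space measure set" where
  "borel_subprobs = {\<rho>. sets \<rho> = sets borel \<and> emeasure \<rho> UNIV \<le> 1}"

definition weak_star_conv ::
    "(nat \<Rightarrow> 'a::real_normed_vector measure) \<Rightarrow> 'a measure \<Rightarrow> bool" where
  "weak_star_conv \<rho>s \<rho> \<longleftrightarrow>
    (\<forall>\<phi>::'a \<Rightarrow> real. continuous_on UNIV \<phi> \<and> (\<phi> \<longlongrightarrow> 0) at_infinity \<longrightarrow>
      (\<lambda>n. \<integral>x. \<phi> x \<partial>\<rho>s n) \<longlonglongrightarrow> (\<integral>x. \<phi> x \<partial>\<rho>))"

text \<open>In \<^typ>\<open>ennreal\<close>, \<open>1 / 0 = \<infinity>\<close>; this is the convention for coinciding points.\<close>

definition coulomb :: "nat \<Rightarrow> (nat \<Rightarrow> 'a::metric_space) \<Rightarrow> ennreal" where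
  "coulomb N x = (\<Sum>(i, j) \<in> {(i, j). i < j \<and> j < N}. 1 / ennreal (dist (x i) (x j)))"

definition plans :: "nat \<Rightarrow> 'a::topological_space measure \<Rightarrow> (nat \<Rightarrow> 'a) measure set" where
  "plans N \<rho> = {P. sets P = sets (PiM {..<N} (\<lambda>_. borel)) \<and> prob_space P \<and>
                   (\<forall>i<N. distr P borel (\<lambda>x. x i) = \<rho>)}"

definition transport_cost :: "nat \<Rightarrow> 'a::metric_space measure \<Rightarrow> ennreal" where
  "transport_cost N \<rho> = (INF P \<in> plans N \<rho>. \<integral>\<^sup>+ x. coulomb N x \<partial>P)"

definition relaxed_cost :: "nat \<Rightarrow> 'a::real_normed_vector measure \<Rightarrow> ennreal" where
  "relaxed_cost N \<rho> =
    Inf {liminf (\<lambda>n. transport_cost N (\<rho>s n)) | \<rho>s.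
           (\<forall>n. \<rho>s n \<in> borel_probs) \<and> weak_star_conv \<rho>s \<rho>}"

text \<open>
  The one-point compactification lives on \<^typ>\<open>'a option\<close>, with \<^term>\<open>None\<close> as \<open>\<omega>\<close>.
\<close>

abbreviation onept :: "'a::topological_space option topology" where
  "onept \<equiv> Alexandroff_compactification euclidean"

definition onept_borel :: "'a::topological_space option measure" where
  "onept_borel = sigma UNIV {U. openin onept U}"

definition onept_dist_inv :: "'a::metric_space option \<Rightarrow> 'a option \<Rightarrow> ennreal" where
  "onept_dist_inv a b =
    (case (a, b) of (Some x, Some y) \<Rightarrow> 1 / ennreal (dist x y) | _ \<Rightarrow> 0)"

definition onept_coulomb :: "nat \<Rightarrow> (nat \<Rightarrow> 'a::metric_space option) \<Rightarrow> ennreal" where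
  "onept_coulomb N x = (\<Sum>(i, j) \<in> {(i, j). i < j \<and> j < N}. onept_dist_inv (x i) (x j))"

definition onept_extension :: "'a::topological_space measure \<Rightarrow> 'a option measure" where
  "onept_extension \<rho> = measure_of UNIV (sets onept_borel)
    (\<lambda>A. emeasure (distr \<rho> onept_borel Some) A
       + (1 - emeasure \<rho> UNIV) * emeasure (return onept_borel None) A)"

definition lower_semicontinuous_map :: "'a topology \<Rightarrow> ('a \<Rightarrow> real) \<Rightarrow> bool" where
  "lower_semicontinuous_map X u \<longleftrightarrow> (\<forall>a. openin X {x \<in> topspace X. u x > a})"

text \<open>
  The Bochner integral is \<open>0\<close> on non-integrable functions, whereas a lower semicontinuous
  function on a compact space is bounded below but possibly has integral \<open>+\<infinity>\<close>.
\<close>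

definition ext_integral :: "'a measure \<Rightarrow> ('a \<Rightarrow> real) \<Rightarrow> ereal" where
  "ext_integral M u =
    enn2ereal (\<integral>\<^sup>+ x. ennreal (u x) \<partial>M) - enn2ereal (\<integral>\<^sup>+ x. ennreal (- u x) \<partial>M)"

definition dual_admissible :: "nat \<Rightarrow> 'a::metric_space measure \<Rightarrow> ('a option \<Rightarrow> real) \<Rightarrow> bool"
  where
  "dual_admissible N \<rho> u \<longleftrightarrow>
    (AE x in PiM {..<N} (\<lambda>_. onept_extension \<rho>).
       ereal (1 / real N * (\<Sum>i<N. u (x i))) \<le> enn2ereal (onept_coulomb N x))"

lemma ext_integral_eq_lebesgue_integral:
  assumes "integrable M u"
  shows "ext_integral M u = ereal (\<integral>x. u x \<partial>M)"
proof -
  have f: "(\<integral>\<^sup>+ x. ennreal (u x) \<partial>M) \<noteq> \<infinity>" "(\<integral>\<^sup>+ x. ennreal (- u x) \<partial>M) \<noteq> \<infinity>"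
    using assms by (auto simp: real_integrable_def)
  have "enn2ereal a - enn2ereal b = ereal (enn2real a - enn2real b)"
    if "a \<noteq> \<infinity>" "b \<noteq> \<infinity>" for a b :: ennreal
    using that by (cases a; cases b) auto
  from this[OF f] show ?thesis
    unfolding ext_integral_def real_lebesgue_integral_def[OF assms] by simp
qed

lemma space_onept_borel [simp]: "space onept_borel = UNIV"
  by (simp add: onept_borel_def)

lemma Some_measurable [measurable]: "Some \<in> borel \<rightarrow>\<^sub>M onept_borel"
  unfolding onept_borel_def
proof (rule measurable_measure_of)
  fix U :: "'a option set" assume "U \<in> {U. openin onept U}"
  then have "open {x. Some x \<in> U}"
    using openin_continuous_map_preimage[OF continuous_map_Some, of euclidean U] by simp
  then show "Some -` U \<inter> space borel \<in> sets borel"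
    by (simp add: vimage_def)
qed auto

lemma sets_onept_extension [simp]: "sets (onept_extension \<rho>) = sets onept_borel"
  unfolding onept_extension_def
  by (metis sets.sets_measure_of_eq space_onept_borel)

lemma emeasure_onept_extension:
  assumes \<rho>: "sets \<rho> = sets borel" and A: "A \<in> sets onept_borel"
  shows "emeasure (onept_extension \<rho>) A =
    emeasure \<rho> (Some -` A) + (1 - emeasure \<rho> UNIV) * indicator A None"
proof -
  let ?D = "distr \<rho> onept_borel Some" and ?R = "return onept_borel (None :: 'a option)"
  let ?f = "\<lambda>A. emeasure ?D A + (1 - emeasure \<rho> UNIV) * emeasure ?R A"
  have m: "Some \<in> \<rho> \<rightarrow>\<^sub>M onept_borel"
    using Some_measurable measurable_cong_sets[OF \<rho> refl] by blast
  have sp: "space \<rho> = UNIV"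
    using sets_eq_imp_space_eq[OF \<rho>] by simp
  have "emeasure (onept_extension \<rho>) A = ?f A"
  proof (rule emeasure_measure_of[OF onept_extension_def])
    show "sets onept_borel \<subseteq> Pow UNIV" by simp
    show "positive (sets (onept_extension \<rho>)) ?f"
      by (simp add: positive_def)
    show "countably_additive (sets (onept_extension \<rho>)) ?f"
    proof (rule countably_additiveI)
      fix B :: "nat \<Rightarrow> 'a option set"
      assume B: "range B \<subseteq> sets (onept_extension \<rho>)" "disjoint_family B"
      have "(\<Sum>i. ?f (B i)) = (\<Sum>i. emeasure ?D (B i)) + (1 - emeasure \<rho> UNIV) * (\<Sum>i. emeasure ?R (B i))"
        by (simp add: suminf_add[symmetric])
      also have "\<dots> = ?f (\<Union>i. B i)"
        using B by (subst (1 2) suminf_emeasure) auto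
      finally show "(\<Sum>i. ?f (B i)) = ?f (\<Union>i. B i)" .
    qed
    show "A \<in> sets (onept_extension \<rho>)" using A by simp
  qed
  then show ?thesis
    using A m sp by (simp add: emeasure_distr emeasure_return)
qed

lemma prob_space_onept_extension:
  assumes "\<rho> \<in> borel_subprobs"
  shows "prob_space (onept_extension \<rho>)"
proof
  have "space (onept_extension \<rho>) = UNIV"
    using sets_eq_imp_space_eq[OF sets_onept_extension[of \<rho>]] by simp
  moreover have "UNIV \<in> sets (onept_borel :: 'a option measure)"
    using sets.top[of "onept_borel :: 'a option measure"] by simp
  ultimately show "emeasure (onept_extension \<rho>) (space (onept_extension \<rho>)) = 1"
    using assms by (simp add: borel_subprobs_def emeasure_onept_extension)
qed

end

(*
  Weak duality: a function u that is admissible almost everywhere is approximated from below by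
  functions that are Lipschitz for a metric on the compactification, and these are lowered away
  from the support of the extended measure until they satisfy the constraint everywhere up to
  epsilon. Integrating the constraint against plans of the approximating measures and passing to
  the weak* limit bounds the relaxed cost from below.

  Strong duality needs neither a separation theorem nor compactness of sets of measures. Given
  finitely many test functions, take a near-minimiser of the cost of a discrete plan plus a large
  multiple of the squared errors of its averaged marginals on the test functions. The first-order
  condition at this plan is a dual constraint, so the value of the dual problem bounds its cost,
  and hence also its errors. Partitions of unity of decreasing mesh as test functions give a
  weak* convergent sequence of marginals.
*)

theory Submission
  imports Defs "HOL-Number_Theory.Cong"
begin

section \<open>Near-optimal discrete plans\<close>

text \<open>Two extreme classes of potentials enclose both suprema: continuous functions admissible
  everywhere already reach the relaxed cost, and lower semicontinuous functions admissible almost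
  everywhere cannot exceed it. The obstacle in the lower bound is that the approximating measures
  may charge null sets of the extended measure, so an almost-everywhere constraint says nothing
  about their plans until it is repaired pointwise. In the upper bound all competitors are plans
  with countable support: every function is measurable for them, and a mixture with a point mass is
  again such a plan. Near-minimality replaces the existence of a minimiser; its slack is quadratic
  in the mass moved, hence of lower order in the first-order condition. The dual potential read off
  there is constant near infinity, because the test functions have compact support, and so extends
  continuously to \<open>\<omega>\<close>.\<close>

lemma integral_bind_pmf_bounded:
  fixes f :: "'b \<Rightarrow> real"
  assumes "\<And>x. \<bar>f x\<bar> \<le> B"
  shows "(\<integral>x. f x \<partial>bind_pmf p g) = (\<integral>y. (\<integral>x. f x \<partial>g y) \<partial>p)"
  unfolding measure_pmf_bind
  by (rule integral_bind[where K = "count_space UNIV" and B = B and B' = 1])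
     (auto simp: assms measure_pmf_in_subprob_algebra measure_pmf.finite_measure_axioms)

text \<open>
  A near-minimiser \<open>p\<close> of the penalised cost \<open>\<integral> c dp + \<lambda> \<Sum>\<^sub>k (E\<^sub>p f\<^sub>k - q\<^sub>k)\<^sup>2\<close> can hardly be
  improved by moving a little mass to a point \<open>x\<close>; read for every \<open>x\<close>, this says that
  an explicit affine combination of the \<open>f\<^sub>k\<close> lies below \<open>c\<close>.
\<close>

lemma near_optimal_pmf_of_dual_bound:
  fixes c :: "'b \<Rightarrow> ennreal" and f :: "'k \<Rightarrow> 'b \<Rightarrow> real" and q :: "'k \<Rightarrow> real"
  assumes "finite K" and bound: "\<And>k x. k \<in> K \<Longrightarrow> \<bar>f k x\<bar> \<le> 1"
    and dual: "\<And>\<alpha> b. (\<And>x. ennreal (\<alpha> + (\<Sum>k\<in>K. b k * f k x)) \<le> c x) \<Longrightarrow>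
                 \<alpha> + (\<Sum>k\<in>K. b k * q k) \<le> D"
    and "\<epsilon> > 0"
  obtains p where "(\<integral>\<^sup>+x. c x \<partial>measure_pmf p) \<le> ennreal (D + \<epsilon>)"
    and "(\<Sum>k\<in>K. ((\<integral>x. f k x \<partial>measure_pmf p) - q k)\<^sup>2) \<le> \<epsilon>"
proof -
  have D0: "D \<ge> 0"
    using dual[of 0 "\<lambda>_. 0"] by simp
  \<comment> \<open>If \<open>c\<close> were infinite everywhere, every constant would satisfy the
    dual constraint, including \<open>D + 1\<close>, which exceeds the bound
    \<open>D\<close>.\<close>
  have "\<exists>x0. c x0 \<noteq> \<infinity>"
  proof (rule ccontr)
    assume "\<nexists>x0. c x0 \<noteq> \<infinity>"
    then show False
      using dual[of "D + 1" "\<lambda>_. 0"] by simp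
  qed
  then obtain x0 where x0: "c x0 < \<infinity>"
    by (auto simp: top.not_eq_extremum)
  \<comment> \<open>The final estimate bounds \<open>2 * lam\<close> times the sum of squared errors
    by \<open>D + \<epsilon>\<close>; this weight turns the bound into
    \<open>2 * lam * \<epsilon>\<close>.\<close>
  define lam where "lam = (D + \<epsilon>) / (2 * \<epsilon>)"
  have lam: "lam > 0"
    using D0 \<open>\<epsilon> > 0\<close> by (simp add: lam_def)
  define M where "M = 4 * real (card K)"
  have M0: "M \<ge> 0" by (simp add: M_def)
  \<comment> \<open>\<open>\<eta>\<close> is the mass to be moved. Divided by \<open>\<eta>\<close>,
    the change of \<open>J\<close> has two error terms: \<open>lam * \<eta> * B\<close> with
    \<open>B \<le> M\<close>, from the quadratic penalty, and \<open>\<eta>\<close>, from the slack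
    \<open>\<eta>\<^sup>2\<close> of the near-minimiser. Their sum is to be at most
    \<open>\<epsilon>\<close>.\<close>
  define \<eta> where "\<eta> = min (1/2) (\<epsilon> / (1 + lam * M))"
  have lM: "0 < 1 + lam * M" using lam M0 by (simp add: add_pos_nonneg)
  have "\<eta> \<le> \<epsilon> / (1 + lam * M)" by (simp add: \<eta>_def)
  then have eta3: "\<eta> * (1 + lam * M) \<le> \<epsilon>"
    using lM by (simp add: pos_le_divide_eq)
  have "\<eta> \<le> 1/2" unfolding \<eta>_def by (rule min.cobounded1)
  with lM \<open>\<epsilon> > 0\<close> have eta: "0 < \<eta>" "\<eta> \<le> 1/2"
    by (simp_all add: \<eta>_def)
  define E where "E = (\<lambda>p k. \<integral>x. f k x \<partial>measure_pmf p)"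
  define C where "C = (\<lambda>p. \<integral>\<^sup>+x. c x \<partial>measure_pmf p)"
  define J where "J = (\<lambda>p. enn2real (C p) + lam * (\<Sum>k\<in>K. (E p k - q k)\<^sup>2))"
  define S where "S = J ` {p. C p < \<infinity>}"
  have Sne: "S \<noteq> {}"
  proof -
    have "C (return_pmf x0) < \<infinity>" using x0 by (simp add: C_def)
    then show ?thesis by (auto simp: S_def)
  qed
  have J0: "J p \<ge> 0" for p
    unfolding J_def using lam by (intro add_nonneg_nonneg mult_nonneg_nonneg sum_nonneg) auto
  have bdd: "bdd_below S"
    using J0 by (auto simp: S_def intro!: bdd_belowI2[of _ 0])
  have "Inf S < Inf S + \<eta>\<^sup>2" using eta by simp
  from cInf_lessD[OF Sne this] obtain p where p: "C p < \<infinity>" "J p < Inf S + \<eta>\<^sup>2"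
    unfolding S_def by blast
  have Jp: "J p - \<eta>\<^sup>2 < J p'" if "C p' < \<infinity>" for p'
    using p(2) cInf_lower[OF _ bdd, of "J p'"] that by (force simp: S_def)
  have Ebd: "\<bar>E p k\<bar> \<le> 1" if "k \<in> K" for k
  proof -
    have "\<bar>E p k\<bar> \<le> (\<integral>x. \<bar>f k x\<bar> \<partial>measure_pmf p)"
      unfolding E_def by (rule integral_abs_bound)
    also have "\<dots> \<le> 1"
      by (rule measure_pmf.integral_le_const) (auto simp: bound that intro!: measure_pmf.integrable_const_bound[where B=1])
    finally show ?thesis .
  qed
  define e where "e = (\<lambda>k. E p k - q k)"
  \<comment> \<open>\<open>b\<close> is minus the gradient of the penalty at \<open>p\<close>. The
    constant \<open>\<alpha>\<close> gives the affine function the value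
    \<open>enn2real (C p) - \<epsilon>\<close> at the expectations \<open>E p k\<close>, so the
    first-order condition becomes the dual constraint.\<close>
  define b where "b = (\<lambda>k. - 2 * lam * e k)"
  define \<alpha> where "\<alpha> = enn2real (C p) + 2 * lam * (\<Sum>k\<in>K. e k * E p k) - \<epsilon>"
  have adm: "ennreal (\<alpha> + (\<Sum>k\<in>K. b k * f k x)) \<le> c x" for x
  proof (cases "c x = \<infinity>")
    case True
    then show ?thesis by simp
  next
    case False
    define r where "r = enn2real (c x)"
    have cx: "c x = ennreal r" and r0: "r \<ge> 0"
      using False by (simp_all add: r_def top.not_eq_extremum)
    define s where "s = enn2real (C p)"
    have Cp: "C p = ennreal s" and s0: "s \<ge> 0"
      using p(1) by (simp_all add: s_def top.not_eq_extremum)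
    define p' where "p' = bind_pmf (bernoulli_pmf \<eta>) (\<lambda>t. if t then return_pmf x else p)"
    have "C p' = c x * ennreal \<eta> + C p * ennreal (1 - \<eta>)"
      unfolding C_def p'_def using eta by simp
    also have "\<dots> = ennreal (r * \<eta> + s * (1 - \<eta>))"
      using eta r0 s0 by (simp add: cx Cp ennreal_mult[symmetric] ennreal_plus[symmetric] del: ennreal_plus)
    finally have Cp': "C p' = ennreal (r * \<eta> + s * (1 - \<eta>))" .
    have Ep': "E p' k = f k x * \<eta> + E p k * (1 - \<eta>)" if "k \<in> K" for k
    proof -
      have "E p' k = (\<integral>t. (\<integral>y. f k y \<partial>(if t then return_pmf x else p)) \<partial>bernoulli_pmf \<eta>)"
        unfolding E_def p'_def
        by (subst integral_bind_pmf_bounded[where B=1]) (auto simp: bound that)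
      also have "\<dots> = f k x * \<eta> + E p k * (1 - \<eta>)"
        using eta by (simp add: E_def)
      finally show ?thesis .
    qed
    define A where "A = (\<Sum>k\<in>K. e k * (f k x - E p k))"
    define B where "B = (\<Sum>k\<in>K. (f k x - E p k)\<^sup>2)"
    have "(\<Sum>k\<in>K. (E p' k - q k)\<^sup>2) = (\<Sum>k\<in>K. (e k)\<^sup>2 + 2 * \<eta> * (e k * (f k x - E p k)) + \<eta>\<^sup>2 * (f k x - E p k)\<^sup>2)"
      by (rule sum.cong) (auto simp: Ep' e_def power2_eq_square algebra_simps)
    also have "\<dots> = (\<Sum>k\<in>K. (e k)\<^sup>2) + 2 * \<eta> * A + \<eta>\<^sup>2 * B"
      by (simp add: A_def B_def sum.distrib sum_distrib_left)
    finally have sq: "(\<Sum>k\<in>K. (E p' k - q k)\<^sup>2) = (\<Sum>k\<in>K. (e k)\<^sup>2) + 2 * \<eta> * A + \<eta>\<^sup>2 * B" .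
    have BM: "B \<le> M"
    proof -
      have "(f k x - E p k)\<^sup>2 \<le> 4" if "k \<in> K" for k
      proof -
        have "\<bar>f k x - E p k\<bar> \<le> 2" using bound[OF that, of x] Ebd[OF that] by linarith
        then have "\<bar>f k x - E p k\<bar>\<^sup>2 \<le> 2\<^sup>2" by (intro power_mono) auto
        then show ?thesis by simp
      qed
      from sum_bounded_above[OF this] show ?thesis by (simp add: B_def M_def mult.commute)
    qed
    have "J p - \<eta>\<^sup>2 < J p'"
      by (rule Jp) (simp add: Cp')
    moreover have "J p' = r * \<eta> + s * (1 - \<eta>) + lam * ((\<Sum>k\<in>K. (e k)\<^sup>2) + 2 * \<eta> * A + \<eta>\<^sup>2 * B)"
      using eta r0 s0 by (simp add: J_def Cp' sq del: ennreal_plus)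
    moreover have "J p = s + lam * (\<Sum>k\<in>K. (e k)\<^sup>2)"
      using s0 by (simp add: J_def Cp e_def)
    ultimately have "0 < \<eta> * (r - s + 2 * lam * A + lam * \<eta> * B + \<eta>)"
      by (simp add: algebra_simps power2_eq_square)
    then have 1: "0 < r - s + 2 * lam * A + lam * \<eta> * B + \<eta>"
      using eta by (simp add: zero_less_mult_iff)
    have "lam * \<eta> * B \<le> lam * \<eta> * M"
      using BM lam eta by (intro mult_left_mono) auto
    with eta3 have 2: "lam * \<eta> * B + \<eta> \<le> \<epsilon>" by (simp add: algebra_simps)
    have "\<alpha> + (\<Sum>k\<in>K. b k * f k x) = s - 2 * lam * A - \<epsilon>"
      by (simp add: \<alpha>_def b_def A_def s_def sum_distrib_left sum_subtractf algebra_simps sum_negf)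
    with 1 2 have "\<alpha> + (\<Sum>k\<in>K. b k * f k x) \<le> r" by linarith
    then show ?thesis by (simp add: cx ennreal_leI)
  qed
  \<comment> \<open>At the targets \<open>q\<close> the linear part contributes the penalty twice,
    so the dual bound \<open>D\<close> controls the cost and the errors at once.\<close>
  have *: "\<alpha> + (\<Sum>k\<in>K. b k * q k) = enn2real (C p) + 2 * lam * (\<Sum>k\<in>K. (e k)\<^sup>2) - \<epsilon>"
    by (simp add: \<alpha>_def b_def e_def sum_distrib_left sum_subtractf power2_eq_square algebra_simps sum_negf sum.distrib)
  have le: "enn2real (C p) + 2 * lam * (\<Sum>k\<in>K. (e k)\<^sup>2) \<le> D + \<epsilon>"
    using dual[OF adm] unfolding * by linarith
  have s0: "0 \<le> (\<Sum>k\<in>K. (e k)\<^sup>2)" by (intro sum_nonneg) auto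
  have "0 \<le> 2 * lam * (\<Sum>k\<in>K. (e k)\<^sup>2)" using lam s0 by simp
  with le have "enn2real (C p) \<le> D + \<epsilon>" by linarith
  then have c: "C p \<le> ennreal (D + \<epsilon>)"
    using p(1) by (metis ennreal_enn2real ennreal_leI infinity_ennreal_def)
  have "2 * lam * (\<Sum>k\<in>K. (e k)\<^sup>2) \<le> D + \<epsilon>"
    using le enn2real_nonneg[of "C p"] by linarith
  also have "D + \<epsilon> = 2 * lam * \<epsilon>" using \<open>\<epsilon> > 0\<close> by (simp add: lam_def)
  finally have "(\<Sum>k\<in>K. (e k)\<^sup>2) \<le> \<epsilon>" using lam by simp
  with c show thesis by (intro that[of p]) (simp_all add: C_def E_def e_def)
qed

section \<open>Symmetrisation of plans\<close>

text \<open>The restriction \<open>i < j\<close> is not preserved by a permutation, but the set of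
  ordered pairs of distinct indices is; permutation invariance then becomes a reindexing.\<close>

lemma coulomb_eq_half_sum:
  "2 * coulomb N x = (\<Sum>(i, j) \<in> {(i, j). i < N \<and> j < N \<and> i \<noteq> j}. 1 / ennreal (dist (x i) (x j)))"
proof -
  let ?f = "\<lambda>(i, j). 1 / ennreal (dist (x i) (x j))"
  let ?A = "{(i, j). i < j \<and> j < N}" and ?B = "{(i, j). j < i \<and> i < N}"
  have fin: "finite ?A" "finite ?B"
    by (auto intro: finite_subset[of _ "{..<N} \<times> {..<N}"])
  have "sum ?f ?B = sum ?f ?A"
    by (rule sum.reindex_bij_witness[of _ prod.swap prod.swap]) (auto simp: dist_commute)
  then have "2 * coulomb N x = sum ?f ?A + sum ?f ?B"
    by (simp add: coulomb_def mult_2)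
  also have "\<dots> = sum ?f (?A \<union> ?B)"
    using fin by (intro sum.union_disjoint[symmetric]) auto
  also have "?A \<union> ?B = {(i, j). i < N \<and> j < N \<and> i \<noteq> j}"
    by auto
  finally show ?thesis .
qed

lemma coulomb_permute:
  assumes "bij_betw \<pi> {..<N} {..<N}"
  shows "coulomb N (\<lambda>i. x (\<pi> i)) = coulomb N x"
proof -
  let ?A = "{(i, j). i < N \<and> j < N \<and> i \<noteq> j}"
  have inj: "inj_on \<pi> {..<N}" and im: "\<pi> ` {..<N} = {..<N}"
    using assms by (auto simp: bij_betw_def)
  have "bij_betw (map_prod \<pi> \<pi>) ?A ?A"
    unfolding bij_betw_def
  proof
    show "inj_on (map_prod \<pi> \<pi>) ?A"
      using inj by (auto simp: inj_on_def)
    show "map_prod \<pi> \<pi> ` ?A = ?A"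
    proof safe
      fix i j assume "i < N" "j < N" "i \<noteq> j"
      then obtain i' j' where "i' < N" "j' < N" "i = \<pi> i'" "j = \<pi> j'"
        using im by (metis imageE lessThan_iff)
      then show "(i, j) \<in> map_prod \<pi> \<pi> ` ?A"
        using \<open>i \<noteq> j\<close> by (intro image_eqI[of _ _ "(i', j')"]) auto
    qed (use inj im in \<open>auto simp: inj_on_def\<close>)
  qed
  from sum.reindex_bij_betw[OF this, of "\<lambda>(i, j). 1 / ennreal (dist (x i) (x j))"]
  have "2 * coulomb N (\<lambda>i. x (\<pi> i)) = 2 * coulomb N x"
    by (simp add: coulomb_eq_half_sum case_prod_beta)
  then show ?thesis
    by (simp add: ennreal_mult_cancel_left)
qed

lemma bij_betw_shift_mod:
  "bij_betw (\<lambda>i. (i + k) mod N) {..<N} {..<N::nat}"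
proof (cases "N = 0")
  case False
  have "inj_on (\<lambda>i. (i + k) mod N) {..<N}"
    by (auto simp: inj_on_def) (metis mod_less cong_add_rcancel_nat cong_def)
  moreover have "(\<lambda>i. (i + k) mod N) ` {..<N} \<subseteq> {..<N}"
    using False by auto
  ultimately show ?thesis
    by (simp add: bij_betw_def endo_inj_surj)
qed (simp add: bij_betw_def)

lemma borel_measurable_coulomb [measurable]:
  "coulomb N \<in> borel_measurable (PiM {..<N} (\<lambda>_. borel :: 'a::euclidean_space measure))"
proof -
  have "(\<lambda>x. \<Sum>ij \<in> {(i, j). i < j \<and> j < N}. 1 / ennreal (dist (x (fst ij)) (x (snd ij))))
      \<in> borel_measurable (PiM {..<N} (\<lambda>_. borel :: 'a measure))"
    by (rule borel_measurable_sum) auto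
  then show ?thesis
    by (simp add: coulomb_def[abs_def] case_prod_beta)
qed

lemma coulomb_cong: "(\<And>i. i < N \<Longrightarrow> x i = y i) \<Longrightarrow> coulomb N x = coulomb N y"
  unfolding coulomb_def by (intro sum.cong) auto

text \<open>The plan is symmetrised by averaging over the cyclic shifts of the indices.\<close>

lemma symmetrised_pmf:
  fixes p :: "(nat \<Rightarrow> 'a::euclidean_space) pmf"
  assumes "N > 0"
  obtains \<mu> where "\<mu> \<in> borel_probs"
    and "transport_cost N \<mu> \<le> (\<integral>\<^sup>+x. coulomb N x \<partial>measure_pmf p)"
    and "\<And>g B. g \<in> borel_measurable borel \<Longrightarrow> (\<And>z. \<bar>g z\<bar> \<le> B) \<Longrightarrow>
           (\<integral>z. g z \<partial>\<mu>) = (\<integral>x. 1 / real N * (\<Sum>i<N. g (x i)) \<partial>measure_pmf p)"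
proof -
  let ?U = "pmf_of_set {..<N}"
  let ?M = "PiM {..<N} (\<lambda>_. borel) :: (nat \<Rightarrow> 'a) measure"
  have ne [simp]: "{..<N} \<noteq> {}"
    using assms by auto
  \<comment> \<open>Law of a uniformly chosen coordinate, that is, the average of the marginals of
    \<open>p\<close>.\<close>
  define m where "m = map_pmf (\<lambda>(k, x). x k) (pair_pmf ?U p)"
  define \<mu> where "\<mu> = distr (measure_pmf m) borel (\<lambda>z. z)"
  \<comment> \<open>\<open>T\<close> rotates the tuple by a random offset, so each coordinate of the
    image is a uniformly chosen one. The restriction to \<open>{..<N}\<close> puts it into the space
    of the product measure, which contains only extensional functions.\<close>
  define T where "T = (\<lambda>(k, x :: nat \<Rightarrow> 'a). \<lambda>i\<in>{..<N}. x ((k + i) mod N))"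
  define P where "P = distr (measure_pmf (pair_pmf ?U p)) ?M T"
  have T: "T \<in> measure_pmf (pair_pmf ?U p) \<rightarrow>\<^sub>M ?M"
    by (auto simp: T_def space_PiM split: if_splits)
  have mu: "\<mu> \<in> borel_probs"
    by (auto simp: borel_probs_def \<mu>_def intro!: measure_pmf.prob_space_distr)
  have "P \<in> plans N \<mu>"
    unfolding plans_def
  proof (intro CollectI conjI allI impI)
    show "sets P = sets ?M" by (simp add: P_def)
    show "prob_space P"
      unfolding P_def by (rule measure_pmf.prob_space_distr[OF T])
    fix i assume i: "i < N"
    have "distr P borel (\<lambda>x. x i) = distr (measure_pmf (pair_pmf ?U p)) borel (\<lambda>y. T y i)"
      unfolding P_def using i by (subst distr_distr[OF _ T]) (auto simp: comp_def)
    also have "\<dots> = distr (measure_pmf (map_pmf (\<lambda>y. T y i) (pair_pmf ?U p))) borel (\<lambda>z. z)"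
      unfolding map_pmf_rep_eq by (subst distr_distr) (auto simp: comp_def)
    also have "map_pmf (\<lambda>y. T y i) (pair_pmf ?U p)
        = map_pmf (\<lambda>(k, x). x k) (map_pmf (apfst (\<lambda>k. (k + i) mod N)) (pair_pmf ?U p))"
      using i by (auto simp: pmf.map_comp comp_def T_def apfst_def map_prod_def case_prod_beta)
    \<comment> \<open>Adding \<open>i\<close> modulo \<open>N\<close> permutes the offsets and hence
      preserves their uniform law.\<close>
    also have "\<dots> = m"
      unfolding pair_map_pmf1[symmetric] m_def
      using assms by (subst map_pmf_of_set_bij_betw[OF bij_betw_shift_mod]) auto
    finally show "distr P borel (\<lambda>x. x i) = \<mu>" by (simp add: \<mu>_def)
  qed
  then have "transport_cost N \<mu> \<le> (\<integral>\<^sup>+x. coulomb N x \<partial>P)"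
    unfolding transport_cost_def by (rule INF_lower)
  also have "\<dots> = (\<integral>\<^sup>+y. coulomb N (T y) \<partial>measure_pmf (pair_pmf ?U p))"
    unfolding P_def by (rule nn_integral_distr[OF T]) simp
  also have "\<dots> = (\<integral>\<^sup>+y. coulomb N (snd y) \<partial>measure_pmf (pair_pmf ?U p))"
  proof (rule nn_integral_cong)
    fix y :: "nat \<times> (nat \<Rightarrow> 'a)"
    have "coulomb N (T y) = coulomb N (\<lambda>i. snd y ((i + fst y) mod N))"
      by (rule coulomb_cong) (simp add: T_def case_prod_beta add.commute)
    then show "coulomb N (T y) = coulomb N (snd y)"
      by (simp only: coulomb_permute[OF bij_betw_shift_mod])
  qed
  also have "\<dots> = (\<integral>\<^sup>+x. coulomb N x \<partial>measure_pmf (map_pmf snd (pair_pmf ?U p)))"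
    by (simp only: nn_integral_map_pmf)
  also have "\<dots> = (\<integral>\<^sup>+x. coulomb N x \<partial>measure_pmf p)"
    by (simp only: map_snd_pair_pmf)
  finally have cost: "transport_cost N \<mu> \<le> (\<integral>\<^sup>+x. coulomb N x \<partial>measure_pmf p)" .
  have "(\<integral>z. g z \<partial>\<mu>) = (\<integral>x. 1 / real N * (\<Sum>i<N. g (x i)) \<partial>measure_pmf p)"
    if g: "g \<in> borel_measurable borel" "\<And>z. \<bar>g z\<bar> \<le> B" for g B
  proof -
    have "(\<integral>z. g z \<partial>\<mu>) = (\<integral>y. g (snd y (fst y)) \<partial>measure_pmf (pair_pmf ?U p))"
      using g(1) by (simp add: \<mu>_def m_def integral_distr case_prod_beta)
    also have "pair_pmf ?U p = bind_pmf p (\<lambda>x. map_pmf (\<lambda>k. (k, x)) ?U)"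
      unfolding pair_pmf_def map_pmf_def by (rule bind_commute_pmf)
    also have "(\<integral>y. g (snd y (fst y)) \<partial>measure_pmf \<dots>)
        = (\<integral>x. 1 / real N * (\<Sum>i<N. g (x i)) \<partial>measure_pmf p)"
      using assms g(2) by (subst integral_bind_pmf_bounded[where B=B]) (auto simp: integral_pmf_of_set)
    finally show ?thesis .
  qed
  with mu cost show thesis by (rule that)
qed

section \<open>Functions and integrals on the compactification\<close>

text \<open>For negative \<open>a\<close> both sides hold, since \<open>ennreal\<close> sends
  \<open>a\<close> to \<open>0\<close> and \<open>enn2ereal b\<close> is nonnegative; admissibility
  can thus be handled in \<open>ennreal\<close>.\<close>

lemma ereal_le_enn2ereal_iff: "ereal a \<le> enn2ereal b \<longleftrightarrow> ennreal a \<le> b"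
  by (cases b) (auto simp: ennreal_le_iff2 order.trans)

lemma continuous_map_onept:
  fixes u :: "'a::{real_normed_vector, heine_borel} option \<Rightarrow> real"
  assumes cont: "continuous_on UNIV (\<lambda>x. u (Some x))"
    and lim: "((\<lambda>x. u (Some x)) \<longlongrightarrow> u None) at_infinity"
  shows "continuous_map onept euclideanreal u"
  unfolding continuous_map
proof (intro conjI allI impI)
  fix V :: "real set" assume "openin euclideanreal V"
  then have V: "open V" by simp
  have op: "open {x. u (Some x) \<in> V}"
    using open_vimage[OF V cont] by (simp add: vimage_def)
  let ?U = "{a \<in> topspace onept. u a \<in> V}"
  show "openin onept ?U"
  proof (cases "u None \<in> V")
    case False
    have "?U = Some ` {x. u (Some x) \<in> V}"
    proof (intro set_eqI iffI)
      fix a assume a: "a \<in> ?U"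
      then show "a \<in> Some ` {x. u (Some x) \<in> V}"
        using False by (cases a) auto
    qed auto
    then show ?thesis
      unfolding openin_Alexandroff_compactification using op by auto
  next
    case True
    let ?C = "{x. u (Some x) \<notin> V}"
    from topological_tendstoD[OF lim V True] obtain r where r: "\<And>x. r \<le> norm x \<Longrightarrow> u (Some x) \<in> V"
      unfolding eventually_at_infinity by blast
    have "bounded ?C"
      unfolding bounded_iff using r by (intro exI[of _ r]) (auto intro: le_cases)
    moreover have "closed ?C"
      using op by (simp add: closed_def Collect_neg_eq[symmetric])
    ultimately have "compact ?C" "closed ?C"
      by (simp_all add: compact_eq_bounded_closed)
    moreover have "?U = insert None (Some ` (topspace euclidean - ?C))"
    proof (intro set_eqI iffI)
      fix a assume a: "a \<in> ?U"
      then show "a \<in> insert None (Some ` (topspace euclidean - ?C))"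
        by (cases a) auto
    qed (use True in auto)
    ultimately show ?thesis
      unfolding openin_Alexandroff_compactification by auto
  qed
qed auto

lemma continuous_imp_lower_semicontinuous_map:
  assumes "continuous_map X euclideanreal u"
  shows "lower_semicontinuous_map X u"
  unfolding lower_semicontinuous_map_def
proof
  fix a :: real
  from openin_continuous_map_preimage[OF assms, of "{a<..}"]
  show "openin X {x \<in> topspace X. a < u x}" by simp
qed

lemma insert_None_range_Some [simp]: "insert None (range Some) = UNIV"
  by (auto simp: UNIV_option_conv)

lemma borel_measurable_lower_semicontinuous_map:
  fixes u :: "'a::topological_space option \<Rightarrow> real"
  assumes "lower_semicontinuous_map onept u"
  shows "u \<in> borel_measurable onept_borel"
  unfolding borel_measurable_iff_greater
proof
  fix a
  have "openin onept {x. a < u x}"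
    using assms by (simp add: lower_semicontinuous_map_def)
  then show "{w \<in> space onept_borel. a < u w} \<in> sets onept_borel"
    by (auto simp: onept_borel_def)
qed

lemma lower_semicontinuous_map_bounded_below:
  assumes "lower_semicontinuous_map X u" "compact_space X"
  obtains B where "\<And>x. x \<in> topspace X \<Longrightarrow> B \<le> u x"
proof -
  let ?U = "\<lambda>n::nat. {x \<in> topspace X. - real n < u x}"
  have "topspace X \<subseteq> (\<Union>n. ?U n)"
  proof
    fix x assume x: "x \<in> topspace X"
    obtain n :: nat where "- u x < real n" using reals_Archimedean2 by blast
    then have "- real n < u x" by simp
    with x show "x \<in> (\<Union>n. ?U n)" by blast
  qed
  moreover have "openin X (?U n)" for n
    using assms(1) by (simp add: lower_semicontinuous_map_def)
  ultimately obtain F where F: "finite F" "F \<subseteq> range ?U" "topspace X \<subseteq> \<Union>F"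
    using assms(2) unfolding compact_space_def compactin_def by (metis (no_types, lifting) imageE)
  then obtain I where I: "finite I" "F = ?U ` I"
    by (metis (no_types, lifting) finite_subset_image)
  show thesis
  proof (rule that[of "- real (Max (insert 0 I))"])
    fix x assume "x \<in> topspace X"
    then obtain n where n: "n \<in> I" "- real n < u x" using F I by auto
    have "n \<le> Max (insert 0 I)" using n I by auto
    then have "real n \<le> real (Max (insert 0 I))" by (rule of_nat_mono)
    then show "- real (Max (insert 0 I)) \<le> u x" using n by linarith
  qed
qed

lemma continuous_map_onept_bounded:
  fixes u :: "'a::topological_space option \<Rightarrow> real"
  assumes "continuous_map onept euclideanreal u"
  obtains B where "\<And>x. \<bar>u x\<bar> \<le> B"
proof -
  obtain B1 where "\<And>x. x \<in> topspace (onept :: 'a option topology) \<Longrightarrow> B1 \<le> u x"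
    using lower_semicontinuous_map_bounded_below[OF continuous_imp_lower_semicontinuous_map[OF assms]]
    by auto
  then have B1: "\<And>x. B1 \<le> u x" by auto
  have "continuous_map onept euclideanreal (\<lambda>x. - u x)"
    using assms by (intro continuous_intros)
  from lower_semicontinuous_map_bounded_below[OF continuous_imp_lower_semicontinuous_map[OF this]]
  obtain B2 where "\<And>x. x \<in> topspace (onept :: 'a option topology) \<Longrightarrow> B2 \<le> - u x"
    by auto
  then have B2: "\<And>x. B2 \<le> - u x" by auto
  show thesis
  proof (rule that[of "max (- B1) (- B2)"])
    fix x show "\<bar>u x\<bar> \<le> max (- B1) (- B2)" using B1[of x] B2[of x] by linarith
  qed
qed

section \<open>Integration against the extended measure\<close>

lemma finite_measure_borel_subprob:
  "\<rho> \<in> borel_subprobs \<Longrightarrow> finite_measure \<rho>"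
  using sets_eq_imp_space_eq[of \<rho> borel]
  by (intro finite_measureI) (auto simp: borel_subprobs_def top_unique)

lemma borel_probs_imp_subprobs: "\<mu> \<in> borel_probs \<Longrightarrow> \<mu> \<in> borel_subprobs"
  using prob_space.emeasure_space_1[of \<mu>] sets_eq_imp_space_eq[of \<mu> borel]
  by (auto simp: borel_probs_def borel_subprobs_def)

text \<open>The extension is given through its values on sets, so the formula is built up from
  indicators.\<close>

lemma nn_integral_onept_extension:
  assumes \<rho>: "sets \<rho> = sets borel" and f: "f \<in> borel_measurable onept_borel"
  shows "(\<integral>\<^sup>+a. f a \<partial>onept_extension \<rho>) =
    (\<integral>\<^sup>+x. f (Some x) \<partial>\<rho>) + (1 - emeasure \<rho> UNIV) * f None"
  using f
proof (induction rule: borel_measurable_induct)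
  case (cong f g)
  then show ?case by (simp add: fun_eq_iff[symmetric])
next
  case (set A)
  have "Some -` A \<in> sets \<rho>"
    using measurable_sets[OF Some_measurable set] by (simp add: \<rho>)
  then have "(\<integral>\<^sup>+x. indicator A (Some x) \<partial>\<rho>) = emeasure \<rho> (Some -` A)"
    by (subst nn_integral_indicator[symmetric]) (auto intro!: nn_integral_cong simp: indicator_def simp del: nn_integral_indicator)
  with set show ?case by (simp add: emeasure_onept_extension[OF \<rho>])
next
  case (mult u c)
  note [measurable] = mult(2)
  have [measurable]: "(\<lambda>x. u (Some x)) \<in> borel_measurable \<rho>" "u \<in> borel_measurable (onept_extension \<rho>)"
    using measurable_compose[OF Some_measurable mult(2)] mult(2)
    by (simp_all add: measurable_cong_sets[OF \<rho> refl] measurable_cong_sets[OF sets_onept_extension refl])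
  show ?case
    by (simp add: nn_integral_cmult mult.IH distrib_left mult.left_commute)
next
  case (add u v)
  have [measurable]: "(\<lambda>x. u (Some x)) \<in> borel_measurable \<rho>" "u \<in> borel_measurable (onept_extension \<rho>)"
    "(\<lambda>x. v (Some x)) \<in> borel_measurable \<rho>" "v \<in> borel_measurable (onept_extension \<rho>)"
    using measurable_compose[OF Some_measurable add(1)] measurable_compose[OF Some_measurable add(3)] add(1,3)
    by (simp_all add: measurable_cong_sets[OF \<rho> refl] measurable_cong_sets[OF sets_onept_extension refl])
  show ?case
    by (simp add: nn_integral_add add.IH distrib_left ac_simps)
next
  case (seq U)
  have [measurable]: "(\<lambda>x. U i (Some x)) \<in> borel_measurable \<rho>" "U i \<in> borel_measurable (onept_extension \<rho>)" for i
    using measurable_compose[OF Some_measurable seq(1)[of i]] seq(1)[of i]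
    by (simp_all add: measurable_cong_sets[OF \<rho> refl] measurable_cong_sets[OF sets_onept_extension refl])
  have inc: "incseq (\<lambda>i x. U i (Some x))" "incseq (\<lambda>i. U i None)"
    using seq(3) by (auto simp: incseq_def le_fun_def)
  have SUP: "Sup (range U) a = (SUP i. U i a)" for a by (simp add: image_comp)
  have "(\<integral>\<^sup>+a. Sup (range U) a \<partial>onept_extension \<rho>) = (SUP i. \<integral>\<^sup>+a. U i a \<partial>onept_extension \<rho>)"
    unfolding SUP using seq(3) by (intro nn_integral_monotone_convergence_SUP) auto
  also have "\<dots> = (SUP i. (\<integral>\<^sup>+x. U i (Some x) \<partial>\<rho>) + (1 - emeasure \<rho> UNIV) * U i None)"
    by (simp add: seq.IH)
  also have "\<dots> = (SUP i. \<integral>\<^sup>+x. U i (Some x) \<partial>\<rho>) + (SUP i. (1 - emeasure \<rho> UNIV) * U i None)"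
    using inc by (intro ennreal_SUP_add) (auto simp: incseq_def le_fun_def intro!: nn_integral_mono mult_left_mono)
  also have "(SUP i. \<integral>\<^sup>+x. U i (Some x) \<partial>\<rho>) = (\<integral>\<^sup>+x. Sup (range U) (Some x) \<partial>\<rho>)"
    unfolding SUP using inc by (intro nn_integral_monotone_convergence_SUP[symmetric]) auto
  also have "(SUP i. (1 - emeasure \<rho> UNIV) * U i None) = (1 - emeasure \<rho> UNIV) * Sup (range U) None"
    unfolding SUP by (simp add: SUP_mult_left_ennreal)
  finally show ?case .
qed

lemma
  fixes g :: "'a::topological_space option \<Rightarrow> real"
  assumes \<rho>: "\<rho> \<in> borel_subprobs" and g: "g \<in> borel_measurable onept_borel"
    and B: "\<And>a. \<bar>g a\<bar> \<le> B"
  shows integrable_onept_extension: "integrable (onept_extension \<rho>) g"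
    and integrable_Some_borel_subprob: "integrable \<rho> (\<lambda>x. g (Some x))"
    and integral_onept_extension:
      "(\<integral>a. g a \<partial>onept_extension \<rho>) = (\<integral>x. g (Some x) \<partial>\<rho>) + (1 - measure \<rho> UNIV) * g None"
proof -
  have sets: "sets \<rho> = sets borel" and le1: "emeasure \<rho> UNIV \<le> 1"
    using \<rho> by (auto simp: borel_subprobs_def)
  have sp: "space \<rho> = UNIV" using sets_eq_imp_space_eq[OF sets] by simp
  interpret E: prob_space "onept_extension \<rho>"
    using \<rho> by (rule prob_space_onept_extension)
  interpret R: finite_measure \<rho>
    using \<rho> by (rule finite_measure_borel_subprob)
  have gE: "g \<in> borel_measurable (onept_extension \<rho>)"
    using g by (simp add: measurable_cong_sets[OF sets_onept_extension refl])
  have gS: "(\<lambda>x. g (Some x)) \<in> borel_measurable \<rho>"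
    using measurable_compose[OF Some_measurable g] by (simp add: measurable_cong_sets[OF sets refl])
  show iE: "integrable (onept_extension \<rho>) g"
    using gE B by (intro E.integrable_const_bound[where B=B]) auto
  show iS: "integrable \<rho> (\<lambda>x. g (Some x))"
    using gS B by (intro R.integrable_const_bound[where B=B]) auto
  have B0: "0 \<le> g a + B" for a using B[of a] by linarith
  have m: "1 - emeasure \<rho> UNIV = ennreal (1 - measure \<rho> UNIV)" and m0: "measure \<rho> UNIV \<le> 1"
  proof -
    show "measure \<rho> UNIV \<le> 1" using le1 by (simp add: R.emeasure_eq_measure)
    show "1 - emeasure \<rho> UNIV = ennreal (1 - measure \<rho> UNIV)"
      by (simp add: R.emeasure_eq_measure ennreal_minus flip: ennreal_1)
  qed
  \<comment> \<open>Adding \<open>B\<close> makes \<open>g\<close> nonnegative, so the formula for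
    nonnegative functions applies; the constant cancels because the masses on either side add up to
    \<open>1\<close>.\<close>
  have "ennreal (\<integral>a. g a + B \<partial>onept_extension \<rho>) = (\<integral>\<^sup>+a. ennreal (g a + B) \<partial>onept_extension \<rho>)"
    using iE B0 by (intro nn_integral_eq_integral[symmetric]) auto
  also have "\<dots> = (\<integral>\<^sup>+x. ennreal (g (Some x) + B) \<partial>\<rho>) + (1 - emeasure \<rho> UNIV) * ennreal (g None + B)"
    using g by (intro nn_integral_onept_extension[OF sets]) auto
  also have "(\<integral>\<^sup>+x. ennreal (g (Some x) + B) \<partial>\<rho>) = ennreal (\<integral>x. g (Some x) + B \<partial>\<rho>)"
    using iS B0 by (intro nn_integral_eq_integral) auto
  also have "\<dots> + (1 - emeasure \<rho> UNIV) * ennreal (g None + B)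
      = ennreal ((\<integral>x. g (Some x) + B \<partial>\<rho>) + (1 - measure \<rho> UNIV) * (g None + B))"
    using B0 m0 by (simp add: m ennreal_mult ennreal_plus Bochner_Integration.integral_nonneg del: Bochner_Integration.integral_add)
  finally have "(\<integral>a. g a + B \<partial>onept_extension \<rho>)
      = (\<integral>x. g (Some x) + B \<partial>\<rho>) + (1 - measure \<rho> UNIV) * (g None + B)"
    using B0 m0 by (subst (asm) ennreal_inj)
      (auto intro!: Bochner_Integration.integral_nonneg add_nonneg_nonneg simp del: Bochner_Integration.integral_add)
  then show "(\<integral>a. g a \<partial>onept_extension \<rho>) = (\<integral>x. g (Some x) \<partial>\<rho>) + (1 - measure \<rho> UNIV) * g None"
    using iE iS E.prob_space by (simp add: sp algebra_simps)
qed

section \<open>A metric on the compactification and inf-convolutions\<close>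

text \<open>
  A metric inducing the topology of the compactification: \<open>1 / (1 + |x|)\<close> serves as the
  distance of \<open>x\<close> from \<open>\<omega>\<close>, and two points may be joined through \<open>\<omega>\<close>.
\<close>

fun onept_dist :: "'a::real_normed_vector option \<Rightarrow> 'a option \<Rightarrow> real" where
  "onept_dist (Some x) (Some y) = min (dist x y) (inverse (1 + norm x) + inverse (1 + norm y))"
| "onept_dist (Some x) None = inverse (1 + norm x)"
| "onept_dist None (Some y) = inverse (1 + norm y)"
| "onept_dist None None = 0"

lemma inverse_one_plus_norm_pos: "0 < inverse (1 + norm x)"
  by (simp add: add_pos_nonneg)

text \<open>The function \<open>1 / (1 + t)\<close> has slope at most \<open>1\<close> in absolute
  value for \<open>t \<ge> 0\<close>. This yields the triangle inequality for
  \<open>onept_dist\<close>: the distance to \<open>\<omega>\<close> cannot change by more than the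
  Euclidean distance travelled.\<close>

lemma inverse_one_plus_norm_lipschitz:
  "inverse (1 + norm x) \<le> inverse (1 + norm y) + dist x (y :: 'a::real_normed_vector)"
proof -
  have p: "0 < 1 + norm x" "0 < 1 + norm y" by (simp_all add: add_pos_nonneg)
  have "inverse (1 + norm x) - inverse (1 + norm y)
      = (norm y - norm x) * (inverse (1 + norm x) * inverse (1 + norm y))"
    using p by (simp add: field_simps)
  also have "\<dots> \<le> dist x y * (1 * 1)"
  proof (rule mult_mono)
    show "norm y - norm x \<le> dist x y"
      using norm_triangle_ineq2[of y x] by (simp add: dist_norm norm_minus_commute)
    show "inverse (1 + norm x) * inverse (1 + norm y) \<le> 1 * 1"
      using p by (intro mult_mono inverse_le_1_iff[THEN iffD2]) auto
  qed (use p in auto)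
  finally show ?thesis by simp
qed

lemma onept_dist_nonneg: "0 \<le> onept_dist a b"
  by (cases a; cases b) (auto intro: add_nonneg_nonneg)

lemma onept_dist_self [simp]: "onept_dist a a = 0"
  by (cases a) (auto intro: add_nonneg_nonneg)

lemma onept_dist_commute: "onept_dist a b = onept_dist b a"
  by (cases a; cases b) (auto simp: dist_commute add.commute)

lemma onept_dist_triangle: "onept_dist a c \<le> onept_dist a b + onept_dist b c"
proof -
  note lip = inverse_one_plus_norm_lipschitz and pos = inverse_one_plus_norm_pos
  show ?thesis
  proof (cases a; cases b; cases c)
    fix x y z assume *: "a = Some x" "b = Some y" "c = Some z"
    show ?thesis
      unfolding * onept_dist.simps
      using lip[of x y] lip[of z y, unfolded dist_commute[of z y]] dist_triangle[of x z y] pos[of y]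
      by linarith
  next
    fix x y assume *: "a = Some x" "b = Some y" "c = None"
    show ?thesis
      unfolding * onept_dist.simps using lip[of x y] pos[of y] by linarith
  next
    fix y z assume *: "a = None" "b = Some y" "c = Some z"
    show ?thesis
      unfolding * onept_dist.simps
      using lip[of z y, unfolded dist_commute[of z y]] pos[of y] by linarith
  next
    fix y assume *: "a = None" "b = Some y" "c = None"
    show ?thesis
      unfolding * onept_dist.simps using pos[of y] by linarith
  qed auto
qed

lemma onept_dist_ball_subset:
  fixes U :: "'a::euclidean_space option set"
  assumes "openin onept U" "a \<in> U"
  obtains r where "r > 0" "\<And>b. onept_dist a b < r \<Longrightarrow> b \<in> U"
proof (cases a)
  case (Some x)
  have "openin euclidean {x. Some x \<in> U}"
    using openin_continuous_map_preimage[OF continuous_map_Some assms(1)] by simp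
  then obtain r where r: "r > 0" "ball x r \<subseteq> {x. Some x \<in> U}"
    using assms(2) Some by (metis mem_Collect_eq open_contains_ball open_openin)
  show thesis
  \<comment> \<open>Below \<open>inverse (1 + norm x)\<close> the detour through \<open>None\<close>
    is too long: \<open>b\<close> is finite and the minimum is the Euclidean distance.\<close>
  proof (rule that[of "min r (inverse (1 + norm x))"])
    show "0 < min r (inverse (1 + norm x))"
      using r inverse_one_plus_norm_pos[of x] by simp
    fix b assume b: "onept_dist a b < min r (inverse (1 + norm x))"
    show "b \<in> U"
    proof (cases b)
      case (Some y)
      from b have "min (dist x y) (inverse (1 + norm x) + inverse (1 + norm y)) < min r (inverse (1 + norm x))"
        unfolding Some \<open>a = Some x\<close> onept_dist.simps .
      then have "dist x y < r"
        using inverse_one_plus_norm_pos[of y] by linarith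
      then show ?thesis using r Some by auto
    qed (use b \<open>a = Some x\<close> in simp)
  qed
next
  case None
  then obtain C where C: "compact C" "U = insert None (Some ` (- C))"
    using assms unfolding openin_Alexandroff_compactification by (auto simp: Compl_eq_Diff_UNIV)
  obtain R where R: "\<And>x. x \<in> C \<Longrightarrow> norm x \<le> R"
    using compact_imp_bounded[OF C(1)] unfolding bounded_iff by blast
  define S where "S = max R 0"
  have S: "0 < 1 + S" "R \<le> S" by (auto simp: S_def)
  show thesis
  proof (rule that[of "inverse (1 + S)"])
    show "0 < inverse (1 + S)" using S by simp
    fix b assume b: "onept_dist a b < inverse (1 + S)"
    show "b \<in> U"
    proof (cases b)
      case (Some y)
      with b None have "inverse (1 + norm y) < inverse (1 + S)" by simp
      then have "S < norm y"
        using S by (simp add: inverse_less_iff_less add_pos_nonneg)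
      then show ?thesis using R[of y] S C Some by fastforce
    qed (simp add: C)
  qed
qed

lemma tendsto_inverse_one_plus_norm:
  "((\<lambda>x :: 'a::real_normed_vector. inverse (1 + norm x)) \<longlongrightarrow> 0) at_infinity"
proof -
  have "filterlim (\<lambda>x :: 'a. 1 + norm x) at_top at_infinity"
    by (rule filterlim_tendsto_add_at_top[OF tendsto_const filterlim_norm_at_top])
  then show ?thesis by (rule tendsto_inverse_0_at_top)
qed

definition onept_lipschitz :: "real \<Rightarrow> ('a::real_normed_vector option \<Rightarrow> real) \<Rightarrow> bool" where
  "onept_lipschitz k v \<longleftrightarrow> (\<forall>a b. v a \<le> v b + k * onept_dist a b)"

lemma onept_lipschitzD:
  assumes "onept_lipschitz k v"
  shows "\<bar>v a - v b\<bar> \<le> k * onept_dist a b"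
  using assms unfolding onept_lipschitz_def by (simp add: abs_le_iff) (metis onept_dist_commute diff_le_eq add.commute)

lemma
  fixes v :: "'a::real_normed_vector option \<Rightarrow> real"
  assumes v: "onept_lipschitz k v" and "0 \<le> k"
  shows onept_lipschitz_continuous: "continuous_on UNIV (\<lambda>x. v (Some x))"
    and onept_lipschitz_tendsto: "((\<lambda>x. v (Some x)) \<longlongrightarrow> v None) at_infinity"
proof -
  have "\<bar>v (Some x) - v (Some y)\<bar> \<le> k * dist x y" for x y
    by (rule order_trans[OF onept_lipschitzD[OF v, of "Some x" "Some y"]])
       (auto intro!: mult_left_mono \<open>0 \<le> k\<close>)
  then have "k-lipschitz_on UNIV (\<lambda>x. v (Some x))"
    using \<open>0 \<le> k\<close> by (auto simp: lipschitz_on_def dist_real_def)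
  then show "continuous_on UNIV (\<lambda>x. v (Some x))"
    by (rule lipschitz_on_continuous_on)
  have "((\<lambda>x. v (Some x) - v None) \<longlongrightarrow> 0) at_infinity"
  proof (rule Lim_null_comparison)
    show "\<forall>\<^sub>F x in at_infinity. norm (v (Some x) - v None) \<le> k * inverse (1 + norm x)"
      using onept_lipschitzD[OF v, of "Some _" None] by (intro always_eventually) simp
    show "((\<lambda>x::'a. k * inverse (1 + norm x)) \<longlongrightarrow> 0) at_infinity"
      using tendsto_mult_right_zero[OF tendsto_inverse_one_plus_norm] .
  qed
  then show "((\<lambda>x. v (Some x)) \<longlongrightarrow> v None) at_infinity"
    by (simp add: LIM_zero_iff)
qed

lemma onept_lipschitz_measurable:
  fixes v :: "'a::euclidean_space option \<Rightarrow> real"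
  assumes "onept_lipschitz k v" "0 \<le> k"
  shows "v \<in> borel_measurable onept_borel"
  by (intro borel_measurable_lower_semicontinuous_map continuous_imp_lower_semicontinuous_map
      continuous_map_onept onept_lipschitz_continuous[OF assms] onept_lipschitz_tendsto[OF assms])

lemma onept_dist_None_le: "onept_dist a None \<le> 1"
  by (cases a) (auto intro!: inverse_le_1_iff[THEN iffD2])

lemma onept_lipschitz_bounded:
  assumes "onept_lipschitz k v" "0 \<le> k"
  shows "\<bar>v a\<bar> \<le> \<bar>v None\<bar> + k"
  using onept_lipschitzD[OF assms(1), of a None] mult_left_mono[OF onept_dist_None_le[of a] assms(2)]
  by linarith

text \<open>The Pasch-Hausdorff envelope: for \<open>f\<close> bounded below and
  \<open>0 \<le> k\<close>, the largest minorant of \<open>f\<close> that is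
  \<open>k\<close>-Lipschitz for \<open>onept_dist\<close>.\<close>

definition onept_infconv :: "real \<Rightarrow> ('a::real_normed_vector option \<Rightarrow> real) \<Rightarrow> 'a option \<Rightarrow> real" where
  "onept_infconv k f a = (INF b. f b + k * onept_dist a b)"

context
  fixes f :: "'a::real_normed_vector option \<Rightarrow> real" and k L :: real
  assumes low: "\<And>b. L \<le> f b" and k0: "0 \<le> k"
begin

text \<open>A real infimum over a set unbounded below is an unspecified default; the lower bound
  \<open>L\<close> keeps the envelope meaningful.\<close>

lemma bdd_below_onept_infconv: "bdd_below (range (\<lambda>b. f b + k * onept_dist a b))"
  using low k0 by (intro bdd_belowI2[of _ L]) (simp add: add_increasing2 onept_dist_nonneg)

lemma onept_infconv_lower: "onept_infconv k f a \<le> f b + k * onept_dist a b"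
  unfolding onept_infconv_def by (rule cINF_lower[OF bdd_below_onept_infconv]) simp

lemma onept_infconv_le: "onept_infconv k f a \<le> f a"
  using onept_infconv_lower[of a a] by simp

lemma onept_infconv_greatest:
  "(\<And>b. m \<le> f b + k * onept_dist a b) \<Longrightarrow> m \<le> onept_infconv k f a"
  unfolding onept_infconv_def by (rule cINF_greatest) auto

lemma onept_infconv_ge: "L \<le> onept_infconv k f a"
  using low k0 by (intro onept_infconv_greatest) (simp add: add_increasing2 onept_dist_nonneg)

lemma onept_infconv_less:
  assumes "onept_infconv k f a < s"
  obtains b where "f b + k * onept_dist a b < s"
  using assms onept_infconv_greatest[of s a] by (meson not_le)

lemma onept_lipschitz_infconv: "onept_lipschitz k (onept_infconv k f)"
  unfolding onept_lipschitz_def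
proof (intro allI)
  fix a b
  have "onept_infconv k f a - k * onept_dist a b \<le> f c + k * onept_dist b c" for c
  proof -
    have "k * onept_dist a c \<le> k * onept_dist a b + k * onept_dist b c"
      unfolding distrib_left[symmetric] by (intro mult_left_mono onept_dist_triangle k0)
    with onept_infconv_lower[of a c] show ?thesis by linarith
  qed
  then have "onept_infconv k f a - k * onept_dist a b \<le> onept_infconv k f b"
    by (rule onept_infconv_greatest)
  then show "onept_infconv k f a \<le> onept_infconv k f b + k * onept_dist a b" by linarith
qed

end

text \<open>Close to \<open>a\<close>, semicontinuity keeps \<open>u\<close> above any given level
  below \<open>u a\<close>; farther away the penalty \<open>n * onept_dist a b\<close> outweighs the
  drop to the lower bound \<open>L\<close>.\<close>

lemma onept_infconv_tendsto:
  fixes u :: "'a::euclidean_space option \<Rightarrow> real"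
  assumes u: "lower_semicontinuous_map onept u" and low: "\<And>b. L \<le> u b"
  shows "(\<lambda>n. onept_infconv (real n) u a) \<longlonglongrightarrow> u a"
proof (rule order_tendstoI)
  fix s assume "s < u a"
  then obtain s' where s': "s < s'" "s' < u a" using dense by blast
  have "openin onept {b. s' < u b}"
    using u by (simp add: lower_semicontinuous_map_def)
  then obtain r where r: "r > 0" "\<And>b. onept_dist a b < r \<Longrightarrow> s' < u b"
    by (rule onept_dist_ball_subset[where a = a]) (use s' in auto)
  obtain n0 :: nat where n0: "(s' - L) / r < real n0" using reals_Archimedean2 by blast
  have "s < onept_infconv (real n) u a" if "n \<ge> n0" for n
  proof -
    have "s' \<le> u b + real n * onept_dist a b" for b
    proof (cases "onept_dist a b < r")
      case True
      then show ?thesis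
        using r(2)[OF True] by (simp add: add_increasing2 onept_dist_nonneg)
    next
      case False
      have "s' - L \<le> real n0 * r" using n0 r by (simp add: field_simps)
      also have "\<dots> \<le> real n * onept_dist a b"
        using False that r by (intro mult_mono) auto
      finally show ?thesis using low[of b] by linarith
    qed
    then have "s' \<le> onept_infconv (real n) u a"
      by (intro onept_infconv_greatest[OF low]) auto
    with s' show ?thesis by simp
  qed
  then show "\<forall>\<^sub>F n in sequentially. s < onept_infconv (real n) u a"
    unfolding eventually_sequentially by blast
next
  fix t assume "u a < t"
  then show "\<forall>\<^sub>F n in sequentially. onept_infconv (real n) u a < t"
    using onept_infconv_le[where f = u, OF low, of "real _" a]
    by (intro always_eventually allI) (auto intro: le_less_trans)
qed

section \<open>The lower bound\<close>

text \<open>A box with sides of positive measure has positive product measure and cannot lie in a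
  null set. This turns an almost-sure constraint into one valid at some tuple close to a prescribed
  one.\<close>

lemma AE_PiM_imp_exists_PiE:
  assumes I: "finite I" and M: "prob_space M"
    and AE: "AE x in PiM I (\<lambda>_. M). P x"
    and W: "\<And>i. i \<in> I \<Longrightarrow> W i \<in> sets M" "\<And>i. i \<in> I \<Longrightarrow> emeasure M (W i) > 0"
  obtains y where "y \<in> PiE I W" "P y"
proof (rule ccontr)
  interpret M: prob_space M by fact
  interpret product_sigma_finite "\<lambda>_. M" by standard
  assume "\<not> thesis"
  with that have no: "\<And>y. y \<in> PiE I W \<Longrightarrow> \<not> P y" by blast
  from AE obtain Z where Z: "{x \<in> space (PiM I (\<lambda>_. M)). \<not> P x} \<subseteq> Z"
    "emeasure (PiM I (\<lambda>_. M)) Z = 0" "Z \<in> sets (PiM I (\<lambda>_. M))"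
    by (rule AE_E)
  have "PiE I W \<subseteq> space (PiM I (\<lambda>_. M))"
    using W(1) sets.sets_into_space by (auto simp: space_PiM PiE_iff) blast
  with no Z(1) have "PiE I W \<subseteq> Z" by blast
  from emeasure_mono[OF this Z(3)] have "emeasure (PiM I (\<lambda>_. M)) (PiE I W) = 0"
    using Z(2) by simp
  moreover have "emeasure (PiM I (\<lambda>_. M)) (PiE I W) = (\<Prod>i\<in>I. emeasure M (W i))"
    using I W(1) by (intro emeasure_PiM) auto
  ultimately show False
    using I W(2) by (auto simp: prod_zero_iff) (metis less_irrefl)
qed

text \<open>The cut-off at height \<open>L\<close> makes the interaction Lipschitz in finite arguments.\<close>

fun onept_truncated :: "real \<Rightarrow> 'a::metric_space option \<Rightarrow> 'a option \<Rightarrow> real" where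
  "onept_truncated L (Some x) (Some y) = inverse (max (inverse L) (dist x y))"
| "onept_truncated L None _ = 0"
| "onept_truncated L _ None = 0"

context
  fixes L :: real
  assumes L: "0 < L"
begin

lemma onept_truncated_nonneg: "0 \<le> onept_truncated L a b"
  using L by (cases a; cases b) (auto simp: le_max_iff_disj)

lemma onept_truncated_le_dist_inv: "ennreal (onept_truncated L a b) \<le> onept_dist_inv a b"
proof (cases a; cases b)
  fix x y assume *: "a = Some x" "b = Some y"
  show ?thesis
  proof (cases "x = y")
    case False
    then have "inverse (max (inverse L) (dist x y)) \<le> inverse (dist x y)"
      by (intro le_imp_inverse_le) auto
    then have "ennreal (onept_truncated L a b) \<le> ennreal (1 / dist x y)"
      by (intro ennreal_leI) (simp add: * inverse_eq_divide)
    also have "\<dots> = 1 / ennreal (dist x y)"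
      using False divide_ennreal[of 1 "dist x y"] by simp
    finally show ?thesis by (simp add: * onept_dist_inv_def)
  qed (simp add: * onept_dist_inv_def)
qed (auto simp: onept_dist_inv_def)

text \<open>Either some pair reaches the cap, and its term \<open>L\<close> alone is at least
  \<open>r\<close>, or no pair does and truncation has changed nothing.\<close>

lemma le_sum_onept_truncated:
  assumes r: "r \<le> L" and le: "ennreal r \<le> onept_coulomb N x"
  shows "r \<le> (\<Sum>(i, j) \<in> {(i, j). i < j \<and> j < N}. onept_truncated L (x i) (x j))"
proof -
  let ?A = "{(i, j). i < j \<and> j < N}"
  have fin: "finite ?A"
    by (auto intro: finite_subset[of _ "{..<N} \<times> {..<N}"])
  show ?thesis
  proof (cases "\<exists>(i, j) \<in> ?A. onept_truncated L (x i) (x j) = L")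
    case True
    then obtain i j where ij: "(i, j) \<in> ?A" "onept_truncated L (x i) (x j) = L" by blast
    then have "L \<le> (\<Sum>(i, j) \<in> ?A. onept_truncated L (x i) (x j))"
      using member_le_sum[OF ij(1), of "\<lambda>(i, j). onept_truncated L (x i) (x j)"] fin
        onept_truncated_nonneg by (auto simp: case_prod_beta)
    with r show ?thesis by simp
  next
    case False
    have eq: "onept_dist_inv (x i) (x j) = ennreal (onept_truncated L (x i) (x j))"
      if "(i, j) \<in> ?A" for i j
    proof (cases "x i"; cases "x j")
      fix y z assume *: "x i = Some y" "x j = Some z"
      have "onept_truncated L (x i) (x j) \<noteq> L"
        using False that by auto
      then have "\<not> dist y z \<le> inverse L"
        using L by (auto simp: * max_def)
      then have "inverse L < dist y z" by simp
      moreover have "0 < inverse L" using L by simp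
      ultimately have "0 < dist y z" "max (inverse L) (dist y z) = dist y z" by linarith+
      then show ?thesis
        using divide_ennreal[of 1 "dist y z"] by (simp add: * onept_dist_inv_def inverse_eq_divide)
    qed (auto simp: onept_dist_inv_def)
    have "onept_coulomb N x = (\<Sum>ij\<in>?A. ennreal (case ij of (i, j) \<Rightarrow> onept_truncated L (x i) (x j)))"
      unfolding onept_coulomb_def by (rule sum.cong) (auto simp: eq)
    also have "\<dots> = ennreal (\<Sum>(i, j) \<in> ?A. onept_truncated L (x i) (x j))"
      by (rule sum_ennreal) (auto simp: onept_truncated_nonneg)
    finally show ?thesis
      using le by (simp add: ennreal_le_iff sum_nonneg onept_truncated_nonneg case_prod_beta)
  qed
qed

text \<open>The inverse has Lipschitz constant \<open>L\<^sup>2\<close> on arguments at least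
  \<open>inverse L\<close>, and a distance changes by at most the displacements of its two
  endpoints.\<close>

lemma onept_truncated_lipschitz:
  "onept_truncated L (Some x) (Some y) \<le> onept_truncated L (Some x') (Some y') + L\<^sup>2 * (dist x x' + dist y y')"
proof -
  define A where "A = max (inverse L) (dist x y)"
  define B where "B = max (inverse L) (dist x' y')"
  have p: "0 < inverse L" "inverse L \<le> A" "inverse L \<le> B" using L by (auto simp: A_def B_def)
  then have pos: "0 < A" "0 < B" by linarith+
  have iv: "inverse A \<le> L" "inverse B \<le> L"
    using p le_imp_inverse_le[of "inverse L" A] le_imp_inverse_le[of "inverse L" B] by simp_all
  have "0 \<le> dist x x'" "0 \<le> dist y y'" by simp_all
  then have d: "B - A \<le> dist x x' + dist y y'"
    using dist_triangle[of x' y' x] dist_triangle[of x y' y] dist_commute[of x' x]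
    unfolding A_def B_def by linarith
  have "inverse A - inverse B = (B - A) * (inverse A * inverse B)"
    using pos by (simp add: field_simps)
  also have "\<dots> \<le> (dist x x' + dist y y') * (L * L)"
    using d iv pos L by (intro mult_mono) auto
  finally show ?thesis by (simp add: A_def B_def power2_eq_square algebra_simps)
qed

end

text \<open>All marginals of a plan are \<open>\<mu>\<close>, so integrating the pointwise
  constraint turns the average over coordinates into one integral against
  \<open>\<mu>\<close>.\<close>

lemma transport_cost_ge:
  fixes w :: "'a::euclidean_space option \<Rightarrow> real"
  assumes "N > 0" and w: "continuous_on UNIV (\<lambda>x. w (Some x))" "\<And>a. \<bar>w a\<bar> \<le> B"
    and le: "\<And>x. ennreal (1 / real N * (\<Sum>i<N. w (x i)) - \<epsilon>) \<le> onept_coulomb N x"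
    and \<mu>: "\<mu> \<in> borel_probs"
  shows "ennreal ((\<integral>x. w (Some x) \<partial>\<mu>) - \<epsilon>) \<le> transport_cost N \<mu>"
  unfolding transport_cost_def
proof (rule INF_greatest)
  fix P assume "P \<in> plans N \<mu>"
  then have sets: "sets P = sets (PiM {..<N} (\<lambda>_. borel))" and P: "prob_space P"
    and marg: "\<And>i. i < N \<Longrightarrow> distr P borel (\<lambda>x. x i) = \<mu>"
    by (auto simp: plans_def)
  interpret P: prob_space P by fact
  have [measurable]: "(\<lambda>x. w (Some x)) \<in> borel_measurable borel"
    using w(1) by (rule borel_measurable_continuous_onI)
  have m [measurable]: "(\<lambda>x. x i) \<in> P \<rightarrow>\<^sub>M borel" if "i < N" for i
    using that by (simp add: measurable_cong_sets[OF sets refl] measurable_component_singleton)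
  have int: "integrable P (\<lambda>x. w (Some (x i)))" if "i < N" for i
    using m[OF that] w(2) by (intro P.integrable_const_bound[where B=B]) auto
  have eq: "(\<integral>x. w (Some (x i)) \<partial>P) = (\<integral>x. w (Some x) \<partial>\<mu>)" if "i < N" for i
    by (subst marg[OF that, symmetric], subst integral_distr) (use m[OF that] in auto)
  let ?g = "\<lambda>x. 1 / real N * (\<Sum>i<N. w (Some (x i))) - \<epsilon>"
  have isum: "integrable P (\<lambda>x. \<Sum>i<N. w (Some (x i)))"
    using int by (intro Bochner_Integration.integrable_sum) auto
  then have ig: "integrable P ?g"
    by auto
  have "(\<integral>x. ?g x \<partial>P) = 1 / real N * (\<Sum>i<N. \<integral>x. w (Some (x i)) \<partial>P) - \<epsilon>"
    using int isum by (subst Bochner_Integration.integral_sum[symmetric]) (auto simp: P.prob_space)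
  also have "\<dots> = (\<integral>x. w (Some x) \<partial>\<mu>) - \<epsilon>"
    using \<open>N > 0\<close> by (simp add: eq)
  finally have "(\<integral>x. w (Some x) \<partial>\<mu>) - \<epsilon> = (\<integral>x. ?g x \<partial>P)" ..
  \<comment> \<open>\<open>?g\<close> may be negative, while the comparison with the cost is between
    nonnegative integrals; \<open>ennreal\<close> does not distinguish \<open>?g\<close> from its
    positive part.\<close>
  also have "\<dots> \<le> (\<integral>x. max 0 (?g x) \<partial>P)"
    using ig by (intro integral_mono) auto
  finally have "ennreal ((\<integral>x. w (Some x) \<partial>\<mu>) - \<epsilon>) \<le> ennreal (\<integral>x. max 0 (?g x) \<partial>P)"
    by (rule ennreal_leI)
  also have "\<dots> = (\<integral>\<^sup>+x. ennreal (max 0 (?g x)) \<partial>P)"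
    using ig by (intro nn_integral_eq_integral[symmetric]) auto
  also have "\<dots> \<le> (\<integral>\<^sup>+x. coulomb N x \<partial>P)"
  proof (rule nn_integral_mono)
    fix x :: "nat \<Rightarrow> 'a"
    have "ennreal (max 0 (?g x)) = ennreal (?g x)"
      by (cases "?g x \<le> 0") (auto simp: max_def ennreal_neg)
    also have "\<dots> \<le> onept_coulomb N (\<lambda>i. Some (x i))" by (rule le)
    also have "\<dots> = coulomb N x" by (simp add: onept_coulomb_def coulomb_def onept_dist_inv_def)
    finally show "ennreal (max 0 (?g x)) \<le> coulomb N x" .
  qed
  finally show "ennreal ((\<integral>x. w (Some x) \<partial>\<mu>) - \<epsilon>) \<le> (\<integral>\<^sup>+x. coulomb N x \<partial>P)" .
qed

text \<open>It is \<open>w - w None\<close> that vanishes at infinity and passes to the weak* limit.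
  The approximants have mass \<open>1\<close>, so adding \<open>w None\<close> back leaves the lost
  mass times \<open>w None\<close>, which is the contribution of the atom at
  \<open>None\<close>.\<close>

lemma relaxed_cost_ge:
  fixes w :: "'a::euclidean_space option \<Rightarrow> real"
  assumes "N > 0" and \<rho>: "\<rho> \<in> borel_subprobs"
    and w: "onept_lipschitz k w" "0 \<le> k" "\<And>a. \<bar>w a\<bar> \<le> B"
    and le: "\<And>x. ennreal (1 / real N * (\<Sum>i<N. w (x i)) - \<epsilon>) \<le> onept_coulomb N x"
  shows "ennreal ((\<integral>a. w a \<partial>onept_extension \<rho>) - \<epsilon>) \<le> relaxed_cost N \<rho>"
  unfolding relaxed_cost_def
proof (rule Inf_greatest, clarify)
  fix \<rho>s assume \<rho>s: "\<forall>n. \<rho>s n \<in> borel_probs" and conv: "weak_star_conv \<rho>s \<rho>"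
  note c = onept_lipschitz_continuous[OF w(1,2)] and t = onept_lipschitz_tendsto[OF w(1,2)]
  have meas: "w \<in> borel_measurable onept_borel" by (rule onept_lipschitz_measurable[OF w(1,2)])
  have i: "(\<integral>x. w (Some x) - w None \<partial>\<mu>) = (\<integral>x. w (Some x) \<partial>\<mu>) - measure \<mu> UNIV * w None"
    if "\<mu> \<in> borel_subprobs" for \<mu> :: "'a measure"
  proof -
    interpret finite_measure \<mu> using that by (rule finite_measure_borel_subprob)
    have "space \<mu> = UNIV"
      using that sets_eq_imp_space_eq[of \<mu> borel] by (auto simp: borel_subprobs_def)
    then show ?thesis
      using integrable_Some_borel_subprob[OF that meas w(3)] by simp
  qed
  have "((\<lambda>x. w (Some x) - w None) \<longlongrightarrow> 0) at_infinity"
    using tendsto_diff[OF t tendsto_const[of "w None"]] by simp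
  then have "(\<lambda>n. \<integral>x. w (Some x) - w None \<partial>\<rho>s n) \<longlonglongrightarrow> (\<integral>x. w (Some x) - w None \<partial>\<rho>)"
    using conv c unfolding weak_star_conv_def by (simp add: continuous_on_diff)
  moreover have "measure (\<rho>s n) UNIV = 1" for n
    using \<rho>s prob_space.prob_space[of "\<rho>s n"] sets_eq_imp_space_eq[of "\<rho>s n" borel]
    by (auto simp: borel_probs_def)
  ultimately have "(\<lambda>n. (\<integral>x. w (Some x) \<partial>\<rho>s n) - w None) \<longlonglongrightarrow> (\<integral>x. w (Some x) \<partial>\<rho>) - measure \<rho> UNIV * w None"
    using i[OF borel_probs_imp_subprobs] i[OF \<rho>] \<rho>s by simp
  from tendsto_add[OF this tendsto_const[of "w None - \<epsilon>"]]
  have "(\<lambda>n. (\<integral>x. w (Some x) \<partial>\<rho>s n) - \<epsilon>) \<longlonglongrightarrow> (\<integral>a. w a \<partial>onept_extension \<rho>) - \<epsilon>"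
    by (simp add: integral_onept_extension[OF \<rho> meas w(3)] algebra_simps)
  then have "(\<lambda>n. ennreal ((\<integral>x. w (Some x) \<partial>\<rho>s n) - \<epsilon>)) \<longlonglongrightarrow> ennreal ((\<integral>a. w a \<partial>onept_extension \<rho>) - \<epsilon>)"
    by (rule tendsto_ennrealI)
  then have "ennreal ((\<integral>a. w a \<partial>onept_extension \<rho>) - \<epsilon>) = liminf (\<lambda>n. ennreal ((\<integral>x. w (Some x) \<partial>\<rho>s n) - \<epsilon>))"
    by (simp add: lim_imp_Liminf)
  also have "\<dots> \<le> liminf (\<lambda>n. transport_cost N (\<rho>s n))"
    using transport_cost_ge[OF \<open>N > 0\<close> c w(3) le] \<rho>s by (intro Liminf_mono always_eventually) auto
  finally show "ennreal ((\<integral>a. w a \<partial>onept_extension \<rho>) - \<epsilon>) \<le> liminf (\<lambda>n. transport_cost N (\<rho>s n))" .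
qed

section \<open>From constraints almost everywhere to constraints everywhere\<close>

lemma sets_onept_borel_openin: "openin onept U \<Longrightarrow> U \<in> sets onept_borel"
  by (auto simp: onept_borel_def)

lemma measure_complement_cball_tendsto:
  fixes \<rho> :: "'a::euclidean_space measure"
  assumes \<rho>: "\<rho> \<in> borel_subprobs"
  shows "(\<lambda>n. measure \<rho> (- cball 0 (real n))) \<longlonglongrightarrow> 0"
proof -
  interpret finite_measure \<rho> using \<rho> by (rule finite_measure_borel_subprob)
  have sets: "sets \<rho> = sets borel" using \<rho> by (simp add: borel_subprobs_def)
  have "(\<Inter>n. - cball (0::'a) (real n)) = {}"
  proof (rule equals0I)
    fix x :: 'a assume x: "x \<in> (\<Inter>n. - cball 0 (real n))"
    obtain n :: nat where "norm x \<le> real n" using real_arch_simple by blast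
    moreover have "x \<in> - cball 0 (real n)" using x by blast
    ultimately show False by simp
  qed
  moreover have "(\<lambda>n. measure \<rho> (- cball 0 (real n))) \<longlonglongrightarrow> measure \<rho> (\<Inter>n. - cball 0 (real n))"
    by (rule finite_Lim_measure_decseq) (auto simp: sets decseq_def)
  ultimately show ?thesis by simp
qed

text \<open>By compactness finitely many balls of half the radius cover the closed ball. The null
  ones among them form a null set, and a point in any other one has that ball inside its own
  \<open>\<delta>\<close>-ball.\<close>

lemma AE_emeasure_ball_pos:
  fixes \<rho> :: "'a::euclidean_space measure"
  assumes sets: "sets \<rho> = sets borel" and "\<delta> > 0"
  shows "AE x in \<rho>. x \<in> cball 0 R \<longrightarrow> 0 < emeasure \<rho> (ball x \<delta>)"
proof -
  have cover: "cball (0::'a) R \<subseteq> (\<Union>x\<in>cball 0 R. ball x (\<delta> / 2))"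
    using \<open>\<delta> > 0\<close> by auto
  obtain T where T: "finite T" "cball (0::'a) R \<subseteq> (\<Union>x\<in>T. ball x (\<delta> / 2))"
    by (rule compactE_image[OF compact_cball open_ball cover])
  let ?Z = "\<Union>t\<in>{t\<in>T. emeasure \<rho> (ball t (\<delta> / 2)) = 0}. ball t (\<delta> / 2)"
  have "?Z \<in> null_sets \<rho>"
    using T(1) by (intro null_sets_UN') (auto simp: sets null_sets_def countable_finite)
  then show ?thesis
  proof (rule AE_I'; intro subsetI)
    fix x assume "x \<in> {x \<in> space \<rho>. \<not> (x \<in> cball 0 R \<longrightarrow> 0 < emeasure \<rho> (ball x \<delta>))}"
    then have x: "x \<in> cball 0 R" "emeasure \<rho> (ball x \<delta>) = 0" by (auto simp: zero_less_iff_neq_zero)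
    then obtain t where t: "t \<in> T" "x \<in> ball t (\<delta> / 2)" using T(2) by blast
    have "ball t (\<delta> / 2) \<subseteq> ball x \<delta>"
    proof
      fix y assume "y \<in> ball t (\<delta> / 2)"
      then show "y \<in> ball x \<delta>"
        using t(2) dist_triangle[of x y t] by (simp add: dist_commute)
    qed
    then have "emeasure \<rho> (ball t (\<delta> / 2)) \<le> emeasure \<rho> (ball x \<delta>)"
      by (intro emeasure_mono) (auto simp: sets)
    with t x show "x \<in> ?Z" by auto
  qed
qed

text \<open>
  A function that is admissible almost everywhere is made admissible everywhere, up to \<open>\<epsilon>\<close>,
  by subtracting a large multiple of a penalty \<open>\<phi>\<close> with small integral. The penalty is below \<open>1\<close>
  only near points with neighbourhoods of positive mass; there the almost sure constraint, in
  which the cost may be cut off at the supremum of \<open>v\<close> and so becomes Lipschitz, can be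
  transported from a nearby point. At \<open>\<omega>\<close> the only neighbourhood considered is \<open>{\<omega>}\<close>, as the
  cut-off cost does not depend continuously on two points approaching \<open>\<omega>\<close>.
\<close>

lemma dual_admissible_approx:
  fixes v :: "'a::euclidean_space option \<Rightarrow> real"
  assumes N: "N > 0" and \<rho>: "\<rho> \<in> borel_subprobs"
    and v: "onept_lipschitz k v" "0 \<le> k" "\<And>a. \<bar>v a\<bar> \<le> V"
    and adm: "dual_admissible N \<rho> v" and \<epsilon>: "\<epsilon> > 0"
  obtains w l B where "onept_lipschitz l w" "0 \<le> l" "\<And>a. \<bar>w a\<bar> \<le> B"
    and "\<And>x. ennreal (1 / real N * (\<Sum>i<N. w (x i)) - \<epsilon>) \<le> onept_coulomb N x"
    and "(\<integral>a. v a \<partial>onept_extension \<rho>) - \<epsilon> \<le> (\<integral>a. w a \<partial>onept_extension \<rho>)"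
proof -
  interpret R: finite_measure \<rho> using \<rho> by (rule finite_measure_borel_subprob)
  interpret E: prob_space "onept_extension \<rho>"
    using \<rho> by (rule prob_space_onept_extension)
  have sets: "sets \<rho> = sets borel" and le1: "emeasure \<rho> UNIV \<le> 1"
    using \<rho> by (auto simp: borel_subprobs_def)
  have V0: "0 \<le> V" using v(3)[of None] by linarith
  \<comment> \<open>The cap must be positive and dominate the averages of \<open>v\<close>, so that
    the constraint survives truncation of the cost.\<close>
  define L where "L = max V 1"
  have L: "0 < L" "V \<le> L" by (auto simp: L_def)
  \<comment> \<open>Coordinates will move by at most \<open>2 * \<delta>\<close>: this costs
    \<open>2 * k * \<delta>\<close> in \<open>v\<close> and
    \<open>L\<^sup>2 * (4 * \<delta>)\<close> in each of at most \<open>N * N\<close> pairs. The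
    summand \<open>1\<close> makes \<open>Q\<close> positive.\<close>
  define Q where "Q = 2 * k + 4 * real (N * N) * L\<^sup>2 + 1"
  have Q: "Q > 0" using v(2) by (auto simp: Q_def intro!: add_nonneg_pos)
  define \<delta> where "\<delta> = \<epsilon> / Q"
  have \<delta>: "\<delta> > 0" using \<epsilon> Q by (simp add: \<delta>_def)
  have "Q * \<delta> = \<epsilon>" using Q by (simp add: \<delta>_def)
  with \<delta> have \<delta>\<epsilon>: "2 * k * \<delta> + 4 * real (N * N) * L\<^sup>2 * \<delta> \<le> \<epsilon>"
    unfolding Q_def by (simp add: algebra_simps)
  have "(\<lambda>n. real N * V * measure \<rho> (- cball 0 (real n))) \<longlonglongrightarrow> 0"
    using tendsto_mult_right_zero[OF measure_complement_cball_tendsto[OF \<rho>]] .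
  then have "\<forall>\<^sub>F n in sequentially. real N * V * measure \<rho> (- cball 0 (real n)) < \<epsilon>"
    using \<epsilon> by (rule order_tendstoD)
  then obtain n where n: "real N * V * measure \<rho> (- cball 0 (real n)) < \<epsilon>"
    unfolding eventually_sequentially by blast
  define R where "R = real n"
  \<comment> \<open>Within \<open>inverse (1 + R)\<close> of a point of norm at most
    \<open>R\<close> all points are finite, and \<open>onept_dist\<close> to that point is the
    Euclidean distance.\<close>
  define \<delta>1 where "\<delta>1 = min \<delta> (inverse (1 + R))"
  have \<delta>1: "0 < \<delta>1" "\<delta>1 \<le> \<delta>" "\<delta>1 \<le> inverse (1 + R)"
    using \<delta> by (auto simp: \<delta>1_def R_def intro!: add_pos_nonneg)
  \<comment> \<open>\<open>K\<close> collects points whose set \<open>W\<close> has positive mass,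
    the finite ones confined to radius \<open>R\<close>; \<open>None\<close> belongs to it exactly
    when the extension has an atom there.\<close>
  define K where "K = Some ` {z \<in> cball 0 R. 0 < emeasure \<rho> (ball z \<delta>)} \<union> {b. b = None \<and> emeasure \<rho> UNIV < 1}"
  define W where "W = (\<lambda>b. case b of Some z \<Rightarrow> Some ` ball z \<delta> | None \<Rightarrow> {None :: 'a option})"
  have WNone: "{None} \<in> sets (onept_borel :: 'a option measure)"
  proof -
    have "range Some \<in> sets (onept_borel :: 'a option measure)"
      by (rule sets_onept_borel_openin) simp
    then have "space onept_borel - range Some \<in> sets (onept_borel :: 'a option measure)"
      by (rule sets.compl_sets)
    moreover have "space onept_borel - range Some = {None :: 'a option}"
    proof (intro set_eqI)
      fix a :: "'a option"
      show "a \<in> space onept_borel - range Some \<longleftrightarrow> a \<in> {None}" by (cases a) auto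
    qed
    ultimately show ?thesis by simp
  qed
  have Wsets: "W b \<in> sets onept_borel" for b
    using WNone by (auto simp: W_def intro!: sets_onept_borel_openin split: option.splits)
  have Wpos: "0 < emeasure (onept_extension \<rho>) (W b)" if "b \<in> K" for b
  proof (cases b)
    case None
    then have "emeasure \<rho> UNIV < 1" using that by (auto simp: K_def)
    moreover have "Some -` {None :: 'a option} = {}" by auto
    ultimately show ?thesis
      using emeasure_onept_extension[OF sets Wsets[of b]] None by (simp add: W_def diff_gr0_ennreal)
  next
    case (Some z)
    then have "0 < emeasure \<rho> (ball z \<delta>)" using that by (auto simp: K_def)
    then show ?thesis
      using emeasure_onept_extension[OF sets Wsets[of b]] Some
      by (simp add: W_def inj_vimage_image_eq)
  qed
  \<comment> \<open>The asymmetry matters: a finite \<open>c\<close> forces \<open>a\<close> to be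
    finite and Euclidean-close, whereas for \<open>c = None\<close> the point \<open>a\<close> may
    be finite. In that case the interactions of \<open>c\<close> are zero and lie below those of
    \<open>a\<close> anyway.\<close>
  have near: "onept_dist a c \<le> 2 * \<delta> \<and> (\<forall>z. c = Some z \<longrightarrow> (\<exists>x. a = Some x \<and> dist x z \<le> 2 * \<delta>))"
    if near: "b \<in> K" "onept_dist a b < \<delta>1" "c \<in> W b" for a b c
  proof (cases b)
    case None
    then show ?thesis using near \<delta>1 \<delta> by (auto simp: W_def)
  next
    case (Some y)
    then obtain z where z: "c = Some z" "dist y z < \<delta>" using near Some by (auto simp: W_def)
    have "norm y \<le> R" using Some that by (auto simp: K_def)
    then have y: "inverse (1 + R) \<le> inverse (1 + norm y)"
      by (intro le_imp_inverse_le) (auto simp: add_pos_nonneg)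
    have "a \<noteq> None"
    proof
      assume "a = None"
      with near Some have "inverse (1 + norm y) < \<delta>1" by simp
      with y \<delta>1 show False by linarith
    qed
    then obtain x where x: "a = Some x" by auto
    have "min (dist x y) (inverse (1 + norm x) + inverse (1 + norm y)) < \<delta>1"
      using near(2) unfolding Some x onept_dist.simps .
    then have "dist x y < \<delta>1"
      using y \<delta>1 inverse_one_plus_norm_pos[of x] by linarith
    then have d: "dist x z \<le> 2 * \<delta>" using z \<delta>1 dist_triangle[of x z y] by linarith
    then have "onept_dist a c \<le> 2 * \<delta>" unfolding x z onept_dist.simps by linarith
    with d x z show ?thesis by auto
  qed
  define f where "f = (indicator (- K) :: 'a option \<Rightarrow> real)"
  have f: "\<And>b. 0 \<le> f b" by (simp add: f_def)
  have k1: "0 \<le> 1 / \<delta>1" using \<delta>1 by simp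
  \<comment> \<open>The minimum of \<open>1\<close> and the \<open>onept_dist\<close>-distance to
    \<open>K\<close> divided by \<open>\<delta>1\<close> (constantly \<open>1\<close> if
    \<open>K\<close> is empty): zero on \<open>K\<close>, and \<open>1\<close> off its
    \<open>\<delta>1\<close>-neighbourhood.\<close>
  define \<phi> where "\<phi> = onept_infconv (1 / \<delta>1) f"
  note infconv_ge = onept_infconv_ge[where f = f and L = 0 and k = "1 / \<delta>1", OF f k1]
    and infconv_le = onept_infconv_le[where f = f and L = 0 and k = "1 / \<delta>1", OF f k1]
    and infconv_lip = onept_lipschitz_infconv[where f = f and L = 0 and k = "1 / \<delta>1", OF f k1]
    and infconv_less = onept_infconv_less[where f = f and L = 0 and k = "1 / \<delta>1", OF f k1]
  have f1: "f a \<le> 1" for a by (simp add: f_def indicator_def)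
  have \<phi>0: "0 \<le> \<phi> a" and \<phi>f: "\<phi> a \<le> f a" and \<phi>1: "\<phi> a \<le> 1" for a
    using infconv_ge[of a] infconv_le[of a] f1[of a] unfolding \<phi>_def by linarith+
  have \<phi>lip: "onept_lipschitz (1 / \<delta>1) \<phi>"
    unfolding \<phi>_def by (rule infconv_lip)
  have \<phi>near: "\<exists>b\<in>K. onept_dist a b < \<delta>1" if less: "\<phi> a < 1" for a
  proof -
    obtain b where b: "f b + 1 / \<delta>1 * onept_dist a b < 1"
      by (rule infconv_less[OF less[unfolded \<phi>_def]])
    have nn: "0 \<le> 1 / \<delta>1 * onept_dist a b"
      using k1 onept_dist_nonneg by (rule mult_nonneg_nonneg)
    then have "b \<in> K" using b by (auto simp: f_def split: split_indicator_asm)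
    moreover have "onept_dist a b / \<delta>1 < 1" using b f[of b] by simp
    then have "onept_dist a b < \<delta>1" using \<delta>1(1) by simp
    ultimately show ?thesis by blast
  qed
  have \<phi>m: "\<phi> \<in> borel_measurable onept_borel"
    using onept_lipschitz_measurable[OF \<phi>lip k1] .
  have vm: "v \<in> borel_measurable onept_borel"
    using onept_lipschitz_measurable[OF v(1,2)] .
  have \<phi>B: "\<And>a. \<bar>\<phi> a\<bar> \<le> 1" by (simp add: \<phi>0 \<phi>1)
  \<comment> \<open>Either the atom is present and \<open>None\<close> lies in \<open>K\<close>,
    where \<open>\<phi>\<close> vanishes, or its mass is zero.\<close>
  have "(1 - measure \<rho> UNIV) * \<phi> None = 0"
  proof (cases "emeasure \<rho> UNIV < 1")
    case True
    then have "None \<in> K" by (simp add: K_def)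
    then show ?thesis using \<phi>0[of None] \<phi>f[of None] by (simp add: f_def)
  next
    case False
    then have "emeasure \<rho> UNIV = 1" using le1 by simp
    then show ?thesis by (simp add: measure_def)
  qed
  then have "(\<integral>a. \<phi> a \<partial>onept_extension \<rho>) = (\<integral>x. \<phi> (Some x) \<partial>\<rho>)"
    using integral_onept_extension[OF \<rho> \<phi>m \<phi>B] by simp
  also have "\<dots> \<le> (\<integral>x. indicator (- cball 0 R) x \<partial>\<rho>)"
  proof (rule integral_mono_AE)
    show "integrable \<rho> (\<lambda>x. \<phi> (Some x))"
      by (rule integrable_Some_borel_subprob[OF \<rho> \<phi>m \<phi>B])
    show "integrable \<rho> (indicator (- cball 0 R) :: 'a \<Rightarrow> real)"
      by (intro integrable_real_indicator) (auto simp: sets R.emeasure_finite top.not_eq_extremum[symmetric])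
    show "AE x in \<rho>. \<phi> (Some x) \<le> indicator (- cball 0 R) x"
      using AE_emeasure_ball_pos[OF sets \<delta>, of R]
    proof eventually_elim
      case (elim x)
      show ?case
      proof (cases "x \<in> cball 0 R")
        case True
        then have "Some x \<in> K" using elim by (simp add: K_def)
        then show ?thesis using \<phi>f[of "Some x"] True by (simp add: f_def)
      qed (use \<phi>1[of "Some x"] in simp)
    qed
  qed
  also have "\<dots> = measure \<rho> (- cball 0 R)"
    using sets_eq_imp_space_eq[OF sets] by simp
  finally have "real N * V * (\<integral>a. \<phi> a \<partial>onept_extension \<rho>) \<le> real N * V * measure \<rho> (- cball 0 R)"
    using V0 by (intro mult_left_mono) auto
  with n have \<phi>int: "real N * V * (\<integral>a. \<phi> a \<partial>onept_extension \<rho>) \<le> \<epsilon>"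
    by (simp add: R_def)
  \<comment> \<open>A single coordinate with penalty \<open>1\<close> has to outweigh all
    \<open>N\<close> values of \<open>v\<close>, each at most \<open>V\<close>; hence the factor
    \<open>N * V\<close>.\<close>
  define w where "w = (\<lambda>a. v a - real N * V * \<phi> a)"
  have NV: "0 \<le> real N * V" using V0 by simp
  have wv: "w a \<le> v a" for a using NV \<phi>0[of a] by (simp add: w_def)
  show thesis
  proof (rule that[of "k + real N * V * (1 / \<delta>1)" w "V + real N * V"])
    show "0 \<le> k + real N * V * (1 / \<delta>1)"
      using v(2) mult_nonneg_nonneg[OF NV k1] by linarith
    show "onept_lipschitz (k + real N * V * (1 / \<delta>1)) w"
      unfolding onept_lipschitz_def
    proof (intro allI)
      fix a b
      have "v a - v b \<le> k * onept_dist a b"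
        using onept_lipschitzD[OF v(1), of a b] by linarith
      moreover have "\<phi> b - \<phi> a \<le> 1 / \<delta>1 * onept_dist a b"
        using onept_lipschitzD[OF \<phi>lip, of a b] by linarith
      then have "real N * V * (\<phi> b - \<phi> a) \<le> real N * V * (1 / \<delta>1 * onept_dist a b)"
        using NV by (rule mult_left_mono)
      ultimately show "w a \<le> w b + (k + real N * V * (1 / \<delta>1)) * onept_dist a b"
        by (simp add: w_def algebra_simps)
    qed
    show "\<bar>w a\<bar> \<le> V + real N * V" for a
    proof -
      have "0 \<le> real N * V * \<phi> a" "real N * V * \<phi> a \<le> real N * V"
        using mult_nonneg_nonneg[OF NV \<phi>0] mult_left_mono[OF \<phi>1 NV] by simp_all
      then show ?thesis using v(3)[of a] unfolding w_def by linarith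
    qed
    have "(\<integral>a. w a \<partial>onept_extension \<rho>) = (\<integral>a. v a \<partial>onept_extension \<rho>) - real N * V * (\<integral>a. \<phi> a \<partial>onept_extension \<rho>)"
      using integrable_onept_extension[OF \<rho> vm v(3)] integrable_onept_extension[OF \<rho> \<phi>m \<phi>B]
      by (simp add: w_def)
    with \<phi>int show "(\<integral>a. v a \<partial>onept_extension \<rho>) - \<epsilon> \<le> (\<integral>a. w a \<partial>onept_extension \<rho>)" by linarith
    fix x :: "nat \<Rightarrow> 'a option"
    let ?A = "{(i, j). i < j \<and> j < N}"
    show "ennreal (1 / real N * (\<Sum>i<N. w (x i)) - \<epsilon>) \<le> onept_coulomb N x"
    proof (cases "\<forall>i<N. \<phi> (x i) < 1")
      case False
      then obtain j where j: "j < N" "1 \<le> \<phi> (x j)" by (auto simp: not_less)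
      have "1 \<le> (\<Sum>i<N. \<phi> (x i))"
        using j member_le_sum[of j "{..<N}" "\<lambda>i. \<phi> (x i)"] \<phi>0 by auto
      then have "real N * V \<le> real N * V * (\<Sum>i<N. \<phi> (x i))"
        using mult_left_mono[OF _ NV, of 1 "\<Sum>i<N. \<phi> (x i)"] by simp
      moreover have "(\<Sum>i<N. v (x i)) \<le> real N * V"
        using sum_bounded_above[of "{..<N}" "\<lambda>i. v (x i)" V] v(3) by (auto simp: abs_le_iff)
      ultimately have "(\<Sum>i<N. w (x i)) \<le> 0"
        by (simp add: w_def sum_subtractf sum_distrib_left)
      then have "1 / real N * (\<Sum>i<N. w (x i)) \<le> 0"
        by (intro mult_nonneg_nonpos) auto
      with \<epsilon> have "1 / real N * (\<Sum>i<N. w (x i)) - \<epsilon> \<le> 0" by linarith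
      then show ?thesis by (simp add: ennreal_neg)
    next
      case True
      then have "\<forall>i\<in>{..<N}. \<exists>b. b \<in> K \<and> onept_dist (x i) b < \<delta>1" using \<phi>near by blast
      from bchoice[OF this]
      obtain b where b: "\<And>i. i < N \<Longrightarrow> b i \<in> K" "\<And>i. i < N \<Longrightarrow> onept_dist (x i) (b i) < \<delta>1"
        by auto
      \<comment> \<open>The box around the points \<open>b i\<close> contains a tuple that satisfies
        the constraint, and its entries are close to those of \<open>x\<close> as well.\<close>
      obtain y where "y \<in> (\<Pi>\<^sub>E i\<in>{..<N}. W (b i))"
        and yle: "ereal (1 / real N * (\<Sum>i<N. v (y i))) \<le> enn2ereal (onept_coulomb N y)"
      proof (rule AE_PiM_imp_exists_PiE[OF finite_lessThan E.prob_space_axioms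
            adm[unfolded dual_admissible_def], of "\<lambda>i. W (b i)"])
        fix i assume "i \<in> {..<N}"
        then show "W (b i) \<in> sets (onept_extension \<rho>)" "0 < emeasure (onept_extension \<rho>) (W (b i))"
          using Wsets Wpos b(1) by simp_all
      qed
      then have y: "y i \<in> W (b i)" if "i < N" for i using that by (auto simp: PiE_iff)
      have "1 / real N * (\<Sum>i<N. v (y i)) \<le> 1 / real N * (real N * V)"
        using sum_bounded_above[of "{..<N}" "\<lambda>i. v (y i)" V] v(3)
        by (intro mult_left_mono) (auto simp: abs_le_iff)
      then have "1 / real N * (\<Sum>i<N. v (y i)) \<le> L" using N L by simp
      from le_sum_onept_truncated[OF L(1) this] yle
      have "1 / real N * (\<Sum>i<N. v (y i)) \<le> (\<Sum>(i, j)\<in>?A. onept_truncated L (y i) (y j))"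
        by (simp add: ereal_le_enn2ereal_iff)
      also have "\<dots> \<le> (\<Sum>(i, j)\<in>?A. onept_truncated L (x i) (x j) + L\<^sup>2 * (4 * \<delta>))"
      proof (intro sum_mono, clarify)
        fix i j assume ij: "i < j" "j < N"
        have nx: "(\<exists>x'. x i' = Some x' \<and> dist x' z \<le> 2 * \<delta>)" if "i' < N" "y i' = Some z" for i' z
          using near[OF b(1)[OF that(1)] b(2)[OF that(1)] y[OF that(1)]] that(2) by simp
        show "onept_truncated L (y i) (y j) \<le> onept_truncated L (x i) (x j) + L\<^sup>2 * (4 * \<delta>)"
        proof (cases "y i = None \<or> y j = None")
          case True
          then have "onept_truncated L (y i) (y j) = 0" by (cases "y i"; cases "y j") auto
          moreover have "0 \<le> L\<^sup>2 * (4 * \<delta>)" using \<delta> by simp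
          ultimately show ?thesis
            using onept_truncated_nonneg[OF L(1), of "x i" "x j"] by linarith
        next
          case False
          then obtain z z' where z: "y i = Some z" "y j = Some z'" by auto
          obtain t t' where t: "x i = Some t" "dist t z \<le> 2 * \<delta>" "x j = Some t'" "dist t' z' \<le> 2 * \<delta>"
            using nx[of i z] nx[of j z'] z ij by auto
          have "onept_truncated L (y i) (y j) \<le> onept_truncated L (x i) (x j) + L\<^sup>2 * (dist z t + dist z' t')"
            unfolding z t by (rule onept_truncated_lipschitz[OF L(1)])
          also have "L\<^sup>2 * (dist z t + dist z' t') \<le> L\<^sup>2 * (4 * \<delta>)"
            using t by (intro mult_left_mono) (auto simp: dist_commute)
          finally show ?thesis by simp
        qed
      qed
      also have "\<dots> = (\<Sum>(i, j)\<in>?A. onept_truncated L (x i) (x j)) + real (card ?A) * (L\<^sup>2 * (4 * \<delta>))"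
        by (simp add: case_prod_beta sum.distrib)
      also have "real (card ?A) * (L\<^sup>2 * (4 * \<delta>)) \<le> real (N * N) * (L\<^sup>2 * (4 * \<delta>))"
      proof (rule mult_right_mono)
        have "card ?A \<le> card ({..<N} \<times> {..<N})" by (rule card_mono) auto
        then show "real (card ?A) \<le> real (N * N)"
          unfolding card_cartesian_product card_lessThan by (rule of_nat_mono)
        show "0 \<le> L\<^sup>2 * (4 * \<delta>)" using \<delta> by simp
      qed
      finally have vy: "1 / real N * (\<Sum>i<N. v (y i))
          \<le> (\<Sum>(i, j)\<in>?A. onept_truncated L (x i) (x j)) + 4 * real (N * N) * L\<^sup>2 * \<delta>"
        by (simp add: algebra_simps)
      have "(\<Sum>i<N. w (x i)) \<le> (\<Sum>i<N. v (y i) + 2 * k * \<delta>)"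
      proof (rule sum_mono)
        fix i assume "i \<in> {..<N}"
        then have i: "i < N" by simp
        have "onept_dist (x i) (y i) \<le> 2 * \<delta>"
          using near[OF b(1)[OF i] b(2)[OF i] y[OF i]] by simp
        then have "k * onept_dist (x i) (y i) \<le> k * (2 * \<delta>)" using v(2) by (rule mult_left_mono)
        moreover have "k * (2 * \<delta>) = 2 * k * \<delta>" by simp
        ultimately show "w (x i) \<le> v (y i) + 2 * k * \<delta>"
          using onept_lipschitzD[OF v(1), of "x i" "y i"] wv[of "x i"] by linarith
      qed
      then have "1 / real N * (\<Sum>i<N. w (x i)) \<le> 1 / real N * (\<Sum>i<N. v (y i) + 2 * k * \<delta>)"
        by (intro mult_left_mono) auto
      also have "\<dots> = 1 / real N * (\<Sum>i<N. v (y i)) + 2 * k * \<delta>"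
        using N by (simp add: sum.distrib distrib_left)
      finally have "1 / real N * (\<Sum>i<N. w (x i)) - \<epsilon> \<le> (\<Sum>(i, j)\<in>?A. onept_truncated L (x i) (x j))"
        using vy \<delta>\<epsilon> by linarith
      then have "ennreal (1 / real N * (\<Sum>i<N. w (x i)) - \<epsilon>)
          \<le> ennreal (\<Sum>(i, j)\<in>?A. onept_truncated L (x i) (x j))"
        by (rule ennreal_leI)
      also have "\<dots> = (\<Sum>ij\<in>?A. ennreal (case ij of (i, j) \<Rightarrow> onept_truncated L (x i) (x j)))"
        by (rule sum_ennreal[symmetric]) (auto simp: onept_truncated_nonneg[OF L(1)])
      also have "\<dots> \<le> onept_coulomb N x"
        unfolding onept_coulomb_def
        by (rule sum_mono) (auto simp: onept_truncated_le_dist_inv[OF L(1)])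
      finally show ?thesis .
    qed
  qed
qed

section \<open>The lower bound for Lipschitz and lower semicontinuous functions\<close>

lemma relaxed_cost_ge_lipschitz:
  fixes v :: "'a::euclidean_space option \<Rightarrow> real"
  assumes N: "N > 0" and \<rho>: "\<rho> \<in> borel_subprobs"
    and v: "onept_lipschitz k v" "0 \<le> k" "\<And>a. \<bar>v a\<bar> \<le> V"
    and adm: "dual_admissible N \<rho> v"
  shows "ennreal (\<integral>a. v a \<partial>onept_extension \<rho>) \<le> relaxed_cost N \<rho>"
proof -
  let ?I = "\<integral>a. v a \<partial>onept_extension \<rho>"
  have ge: "ennreal (?I - 2 * \<epsilon>) \<le> relaxed_cost N \<rho>" if \<epsilon>: "\<epsilon> > 0" for \<epsilon>
  proof -
    obtain w l B where w: "onept_lipschitz l w" "0 \<le> l" "\<And>a. \<bar>w a\<bar> \<le> B"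
      "\<And>x. ennreal (1 / real N * (\<Sum>i<N. w (x i)) - \<epsilon>) \<le> onept_coulomb N x"
      "?I - \<epsilon> \<le> (\<integral>a. w a \<partial>onept_extension \<rho>)"
      by (rule dual_admissible_approx[OF N \<rho> v adm \<epsilon>]) (rule that)
    have "ennreal (?I - 2 * \<epsilon>) \<le> ennreal ((\<integral>a. w a \<partial>onept_extension \<rho>) - \<epsilon>)"
      using w(5) by (intro ennreal_leI) linarith
    also have "\<dots> \<le> relaxed_cost N \<rho>"
      by (rule relaxed_cost_ge[OF N \<rho> w(1-4)])
    finally show ?thesis .
  qed
  have "(\<lambda>n. ?I - 2 * inverse (real (Suc n))) \<longlonglongrightarrow> ?I - 2 * 0"
    by (rule tendsto_diff[OF tendsto_const tendsto_mult[OF tendsto_const LIMSEQ_inverse_real_of_nat]])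
  then have "(\<lambda>n. ennreal (?I - 2 * inverse (real (Suc n)))) \<longlonglongrightarrow> ennreal ?I"
    using tendsto_ennrealI by simp
  then show ?thesis
    by (rule LIMSEQ_le_const2) (auto intro!: ge)
qed

text \<open>The envelopes lie below \<open>u\<close>, so they inherit admissibility and fall under
  the Lipschitz case; Fatou's lemma passes to the limit. If the relaxed cost is finite,
  integrability of \<open>u\<close> comes out as a consequence.\<close>

lemma relaxed_cost_ge_lower_semicontinuous:
  fixes u :: "'a::euclidean_space option \<Rightarrow> real"
  assumes N: "N > 0" and \<rho>: "\<rho> \<in> borel_subprobs"
    and u: "lower_semicontinuous_map onept u" and adm: "dual_admissible N \<rho> u"
  shows "ext_integral (onept_extension \<rho>) u \<le> enn2ereal (relaxed_cost N \<rho>)"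
proof (cases "relaxed_cost N \<rho>")
  case (real r)
  interpret E: prob_space "onept_extension \<rho>"
    using \<rho> by (rule prob_space_onept_extension)
  obtain B0 where "\<And>a. a \<in> topspace (onept :: 'a option topology) \<Longrightarrow> B0 \<le> u a"
    using lower_semicontinuous_map_bounded_below[OF u] by auto
  then have B0: "B0 \<le> u a" for a by simp
  \<comment> \<open>\<open>B\<close> is nonpositive so that \<open>r - B\<close> is nonnegative and
    comparisons can be read back from \<open>ennreal\<close>.\<close>
  define B where "B = min B0 0"
  have B: "B \<le> u a" for a
    using B0[of a] unfolding B_def by linarith
  have "B \<le> 0" by (simp add: B_def)
  have um: "u \<in> borel_measurable onept_borel"
    using u by (rule borel_measurable_lower_semicontinuous_map)
  then have umE: "u \<in> borel_measurable (onept_extension \<rho>)"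
    by (simp add: measurable_cong_sets[OF sets_onept_extension refl])
  define v where "v = (\<lambda>n. onept_infconv (real n) u)"
  have vlip: "onept_lipschitz (real n) (v n)" for n
    unfolding v_def by (rule onept_lipschitz_infconv[OF B]) simp
  have vB: "B \<le> v n a" and vu: "v n a \<le> u a" for n a
    unfolding v_def by (rule onept_infconv_ge[OF B] onept_infconv_le[OF B], simp)+
  have vbd: "\<bar>v n a\<bar> \<le> \<bar>v n None\<bar> + real n" for n a
    using onept_lipschitz_bounded[OF vlip, of n a] by simp
  have vm: "v n \<in> borel_measurable onept_borel" for n
    by (rule onept_lipschitz_measurable[OF vlip]) simp
  have vint: "integrable (onept_extension \<rho>) (v n)" for n
    by (rule integrable_onept_extension[OF \<rho> vm vbd])
  have le: "(\<integral>\<^sup>+a. ennreal (v n a - B) \<partial>onept_extension \<rho>) \<le> ennreal (r - B)" for n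
  proof -
    have "dual_admissible N \<rho> (v n)"
      using adm unfolding dual_admissible_def
    proof eventually_elim
      case (elim x)
      have "1 / real N * (\<Sum>i<N. v n (x i)) \<le> 1 / real N * (\<Sum>i<N. u (x i))"
        by (intro mult_left_mono sum_mono vu) auto
      then have "ereal (1 / real N * (\<Sum>i<N. v n (x i))) \<le> ereal (1 / real N * (\<Sum>i<N. u (x i)))"
        by (rule ereal_less_eq(3)[THEN iffD2])
      then show ?case using elim by (rule order_trans)
    qed
    then have "ennreal (\<integral>a. v n a \<partial>onept_extension \<rho>) \<le> ennreal r"
      using relaxed_cost_ge_lipschitz[OF N \<rho> vlip _ vbd] real(2) by simp
    then have "(\<integral>a. v n a \<partial>onept_extension \<rho>) \<le> r"
      using real(1) by (simp add: ennreal_le_iff)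
    then have "(\<integral>a. v n a - B \<partial>onept_extension \<rho>) \<le> r - B"
      using vint by (simp add: E.prob_space)
    moreover have "(\<integral>\<^sup>+a. ennreal (v n a - B) \<partial>onept_extension \<rho>) = ennreal (\<integral>a. v n a - B \<partial>onept_extension \<rho>)"
      using vint vB by (intro nn_integral_eq_integral) auto
    ultimately show ?thesis by (simp add: ennreal_leI)
  qed
  have "(\<integral>\<^sup>+a. ennreal (u a - B) \<partial>onept_extension \<rho>)
      = (\<integral>\<^sup>+a. liminf (\<lambda>n. ennreal (v n a - B)) \<partial>onept_extension \<rho>)"
  proof (rule nn_integral_cong)
    fix a
    have "(\<lambda>n. ennreal (v n a - B)) \<longlonglongrightarrow> ennreal (u a - B)"
      unfolding v_def by (intro tendsto_ennrealI tendsto_intros onept_infconv_tendsto[OF u B])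
    then show "ennreal (u a - B) = liminf (\<lambda>n. ennreal (v n a - B))"
      by (simp add: lim_imp_Liminf)
  qed
  also have "\<dots> \<le> liminf (\<lambda>n. \<integral>\<^sup>+a. ennreal (v n a - B) \<partial>onept_extension \<rho>)"
    using vm by (intro nn_integral_liminf) (simp add: measurable_cong_sets[OF sets_onept_extension refl])
  also have "\<dots> \<le> liminf (\<lambda>n. ennreal (r - B))"
    by (intro Liminf_mono always_eventually allI le)
  also have "\<dots> = ennreal (r - B)"
    by (simp add: Liminf_const)
  finally have fin: "(\<integral>\<^sup>+a. ennreal (u a - B) \<partial>onept_extension \<rho>) \<le> ennreal (r - B)" .
  have "integrable (onept_extension \<rho>) (\<lambda>a. u a - B)"
    using umE B fin by (intro integrableI_nonneg) (auto intro: le_less_trans)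
  then have iu: "integrable (onept_extension \<rho>) u"
    using Bochner_Integration.integrable_add[of _ "\<lambda>a. u a - B" "\<lambda>_. B"] by simp
  have "ennreal (\<integral>a. u a - B \<partial>onept_extension \<rho>) = (\<integral>\<^sup>+a. ennreal (u a - B) \<partial>onept_extension \<rho>)"
    using iu B by (intro nn_integral_eq_integral[symmetric]) auto
  with fin have "ennreal (\<integral>a. u a - B \<partial>onept_extension \<rho>) \<le> ennreal (r - B)"
    by simp
  then have "(\<integral>a. u a - B \<partial>onept_extension \<rho>) \<le> r - B"
    using real(1) \<open>B \<le> 0\<close> ennreal_le_iff[of "r - B"] by auto
  then have "(\<integral>a. u a \<partial>onept_extension \<rho>) \<le> r"
    using iu by (simp add: E.prob_space)
  then show ?thesis
    using ext_integral_eq_lebesgue_integral[OF iu] real by (simp add: enn2ereal_ennreal)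
next
  case top
  then show ?thesis by (simp add: top_ereal_def)
qed

section \<open>The upper bound\<close>

lemma exists_partition_of_unity_cball:
  fixes R \<delta> :: real
  assumes "\<delta> > 0"
  obtains Z :: "'a::euclidean_space set" and \<phi> :: "'a \<Rightarrow> 'a \<Rightarrow> real"
    where "finite Z" "\<And>z. continuous_on UNIV (\<phi> z)" "\<And>z x. 0 \<le> \<phi> z x"
      and "\<And>x. (\<Sum>z\<in>Z. \<phi> z x) \<le> 1" "\<And>x. norm x \<le> R \<Longrightarrow> (\<Sum>z\<in>Z. \<phi> z x) = 1"
      and "\<And>z x. \<delta> \<le> dist x z \<Longrightarrow> \<phi> z x = 0"
proof -
  have cover: "cball (0::'a) R \<subseteq> (\<Union>x\<in>cball 0 R. ball x (\<delta> / 2))"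
    using \<open>\<delta> > 0\<close> by auto
  obtain Z where Z: "finite Z" "cball (0::'a) R \<subseteq> (\<Union>x\<in>Z. ball x (\<delta> / 2))"
    by (rule compactE_image[OF compact_cball open_ball cover])
  \<comment> \<open>Tent functions around the centres. Flooring their sum at
    \<open>\<delta> / 2\<close> keeps the denominator positive everywhere; inside the ball some
    centre is closer than \<open>\<delta> / 2\<close>, so the floor is inactive and the quotients
    add up to \<open>1\<close>.\<close>
  define \<psi> where "\<psi> = (\<lambda>z x :: 'a. max 0 (\<delta> - dist x z))"
  define s where "s = (\<lambda>x. max (\<delta> / 2) (\<Sum>z\<in>Z. \<psi> z x))"
  have \<psi>0: "0 \<le> \<psi> z x" for z x by (simp add: \<psi>_def)
  have s: "s x > 0" "(\<Sum>z\<in>Z. \<psi> z x) \<le> s x" for x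
    using \<open>\<delta> > 0\<close> by (auto simp: s_def less_max_iff_disj)
  have s_eq: "s x = (\<Sum>z\<in>Z. \<psi> z x)" if x: "norm x \<le> R" for x
  proof -
    have "x \<in> cball 0 R" using x by simp
    then obtain z where z: "z \<in> Z" "dist z x < \<delta> / 2" using Z by auto
    have "\<delta> / 2 \<le> \<psi> z x"
      unfolding \<psi>_def using z(2) dist_commute[of z x] by linarith
    also have "\<dots> \<le> (\<Sum>z\<in>Z. \<psi> z x)"
      by (rule member_le_sum) (use z Z \<psi>0 in auto)
    finally show ?thesis by (simp add: s_def)
  qed
  show thesis
  proof (rule that[of Z "\<lambda>z x. \<psi> z x / s x"])
    show "continuous_on UNIV (\<lambda>x. \<psi> z x / s x)" for z
    proof (rule continuous_on_divide)
      show "continuous_on UNIV (\<psi> z)" unfolding \<psi>_def by (intro continuous_intros)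
      show "continuous_on UNIV s" unfolding s_def \<psi>_def by (intro continuous_intros)
      show "\<forall>x\<in>UNIV. s x \<noteq> 0" using s(1) by (simp add: less_imp_neq[symmetric])
    qed
    show "0 \<le> \<psi> z x / s x" for z x using \<psi>0 s(1)[of x] by simp
    show "(\<Sum>z\<in>Z. \<psi> z x / s x) \<le> 1" for x
      unfolding sum_divide_distrib[symmetric] using s[of x] by simp
    show "(\<Sum>z\<in>Z. \<psi> z x / s x) = 1" if "norm x \<le> R" for x
      unfolding sum_divide_distrib[symmetric] using s[of x] s_eq[OF that] by simp
    show "\<psi> z x / s x = 0" if "\<delta> \<le> dist x z" for z x
      using that by (simp add: \<psi>_def)
  qed (rule Z)
qed

text \<open>
  The coordinates equal to \<open>\<omega>\<close> are replaced by points far from the others and from each other.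
\<close>

lemma onept_coulomb_ge_of_coulomb_ge:
  fixes u :: "'a::euclidean_space option \<Rightarrow> real"
  assumes le: "\<And>x. ennreal (1 / real N * (\<Sum>i<N. u (Some (x i)))) \<le> coulomb N x"
    and far: "\<And>y. S \<le> norm y \<Longrightarrow> u (Some y) = u None"
  shows "ennreal (1 / real N * (\<Sum>i<N. u (x i))) \<le> onept_coulomb N x"
proof (rule ennreal_le_epsilon)
  fix e :: real assume "e > 0"
  \<comment> \<open>Each of at most \<open>N * N\<close> pairs gains an error of at most
    \<open>1 / C\<close>; this value makes the total at most \<open>e\<close>.\<close>
  define C where "C = (real (N * N) + 1) / e"
  have C: "C > 0" using \<open>e > 0\<close> by (simp add: C_def add_nonneg_pos)
  define M where "M = (\<Sum>i<N. case x i of Some z \<Rightarrow> norm z | None \<Rightarrow> 0)"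
  \<comment> \<open>Norm at least \<open>T\<close> puts a new point beyond \<open>S\<close>, where
    \<open>u\<close> equals \<open>u None\<close>, and at distance at least \<open>C\<close> from
    the finite coordinates, whose norms are at most \<open>M\<close>.\<close>
  define T where "T = M + max S 0 + C"
  have M: "norm z \<le> M" if "i < N" "x i = Some z" for i z
    using member_le_sum[of i "{..<N}" "\<lambda>i. case x i of Some z \<Rightarrow> norm z | None \<Rightarrow> 0"] that
    by (auto simp: M_def split: option.splits)
  have M0: "0 \<le> M" unfolding M_def by (intro sum_nonneg) (auto split: option.splits)
  have T: "0 < T" "S \<le> T" "C \<le> T" "C \<le> T - M" using C M0 by (auto simp: T_def)
  obtain b :: 'a where "b \<in> Basis" using nonempty_Basis by blast
  then have b: "norm b = 1" by simp
  \<comment> \<open>The new points are spaced by multiples of \<open>T\<close> along one direction;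
    \<open>real i + 1\<close> keeps index \<open>0\<close> away from the origin.\<close>
  define y where "y = (\<lambda>i. case x i of Some z \<Rightarrow> z | None \<Rightarrow> (T * (real i + 1)) *\<^sub>R b)"
  have ny: "norm ((T * (real i + 1)) *\<^sub>R b) = T * (real i + 1)" for i
    using T b by (simp add: abs_mult)
  have nT: "T \<le> T * (real i + 1)" for i using T by simp
  have uy: "u (Some (y i)) = u (x i)" for i
  proof (cases "x i")
    case None
    have "S \<le> norm ((T * (real i + 1)) *\<^sub>R b)" using ny[of i] nT[of i] T by linarith
    then show ?thesis using far None by (simp add: y_def)
  qed (simp add: y_def)
  have far_Some: "C \<le> dist ((T * (real i + 1)) *\<^sub>R b) z" if "norm z \<le> M" for i z
  proof -
    have "norm ((T * (real i + 1)) *\<^sub>R b) - norm z \<le> dist ((T * (real i + 1)) *\<^sub>R b) z"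
      unfolding dist_norm by (rule norm_triangle_ineq2)
    with ny[of i] nT[of i] T that show ?thesis by linarith
  qed
  have pair: "1 / ennreal (dist (y i) (y j)) \<le> onept_dist_inv (x i) (x j) + ennreal (1 / C)"
    if ij: "i < j" "j < N" for i j
  proof (cases "x i = None \<or> x j = None")
    case True
    have "C \<le> dist (y i) (y j)"
    proof (cases "x i"; cases "x j")
      assume n: "x i = None" "x j = None"
      have "y j - y i = (T * (real j - real i)) *\<^sub>R b"
        unfolding y_def n by (simp add: algebra_simps)
      then have "dist (y i) (y j) = T * (real j - real i)"
        using T b ij by (simp add: dist_norm norm_minus_commute[of "y i"] abs_mult)
      moreover have "T * 1 \<le> T * (real j - real i)"
        using T ij by (intro mult_left_mono) auto
      ultimately show ?thesis using T by linarith
    next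
      fix z assume n: "x i = None" "x j = Some z"
      show ?thesis using far_Some[OF M[OF _ n(2)]] ij by (simp add: y_def n)
    next
      fix z assume n: "x i = Some z" "x j = None"
      show ?thesis using far_Some[OF M[OF _ n(1)]] ij by (simp add: y_def n dist_commute)
    qed (use True in auto)
    then have "ennreal (1 / dist (y i) (y j)) \<le> ennreal (1 / C)"
      using C by (intro ennreal_leI divide_left_mono mult_pos_pos) auto
    moreover have "0 < dist (y i) (y j)"
      using C \<open>C \<le> dist (y i) (y j)\<close> by linarith
    from divide_ennreal[OF _ this, of 1]
    have "1 / ennreal (dist (y i) (y j)) = ennreal (1 / dist (y i) (y j))" by simp
    ultimately show ?thesis by (simp add: add_increasing)
  next
    case False
    then show ?thesis by (auto simp: y_def onept_dist_inv_def)
  qed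
  let ?A = "{(i, j). i < j \<and> j < N}"
  have "ennreal (1 / real N * (\<Sum>i<N. u (x i))) = ennreal (1 / real N * (\<Sum>i<N. u (Some (y i))))"
    by (simp add: uy)
  also have "\<dots> \<le> coulomb N y" by (rule le)
  also have "\<dots> \<le> (\<Sum>(i, j)\<in>?A. onept_dist_inv (x i) (x j) + ennreal (1 / C))"
    unfolding coulomb_def using pair by (intro sum_mono) auto
  also have "\<dots> = onept_coulomb N x + of_nat (card ?A) * ennreal (1 / C)"
    by (simp add: onept_coulomb_def case_prod_beta sum.distrib)
  also have "of_nat (card ?A) * ennreal (1 / C) \<le> ennreal e"
  proof -
    have "card ?A \<le> card ({..<N} \<times> {..<N})" by (rule card_mono) auto
    then have "real (card ?A) \<le> real (N * N)"
      unfolding card_cartesian_product card_lessThan by (rule of_nat_mono)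
    then have "real (card ?A) * (1 / C) \<le> (real (N * N) + 1) * (1 / C)"
      using C by (intro mult_right_mono) auto
    also have "real (N * N) + 1 = C * e" using \<open>e > 0\<close> by (simp add: C_def)
    also have "C * e * (1 / C) = e" using C by simp
    finally have "ennreal (real (card ?A) * (1 / C)) \<le> ennreal e" by (rule ennreal_leI)
    then show ?thesis using C by (simp add: ennreal_mult[symmetric] ennreal_of_nat_eq_real_of_nat)
  qed
  finally show "ennreal (1 / real N * (\<Sum>i<N. u (x i))) \<le> onept_coulomb N x + ennreal e"
    by (auto intro: add_left_mono)
qed

lemma tendsto_at_infinity_if_zero_outside:
  fixes g :: "'a::real_normed_vector \<Rightarrow> 'b::topological_space"
  assumes "\<And>x. S \<le> norm x \<Longrightarrow> g x = l"
  shows "(g \<longlongrightarrow> l) at_infinity"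
  by (rule tendsto_eventually) (use assms in \<open>auto simp: eventually_at_infinity\<close>)

text \<open>Averaging a test function over the coordinates makes its expectation under a plan an
  integral against the averaged marginal. An affine combination of these averages is itself the
  average of a single potential \<open>u\<close>, so the abstract dual bound becomes the one on the
  compactification.\<close>

lemma near_optimal_marginal:
  fixes \<rho> :: "'a::euclidean_space measure"
  assumes N: "N > 0" and \<rho>: "\<rho> \<in> borel_subprobs"
    and dual: "\<And>u. continuous_map onept euclideanreal u \<Longrightarrow>
        (\<And>x. ennreal (1 / real N * (\<Sum>i<N. u (x i))) \<le> onept_coulomb N x) \<Longrightarrow>
        (\<integral>a. u a \<partial>onept_extension \<rho>) \<le> D"
    and Z: "finite Z" and \<phi>: "\<And>z. continuous_on UNIV (\<phi> z)" "\<And>z x. \<bar>\<phi> z x\<bar> \<le> 1"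
    and supp: "\<And>z x. z \<in> Z \<Longrightarrow> S \<le> norm x \<Longrightarrow> \<phi> z x = 0"
    and \<epsilon>: "\<epsilon> > 0"
  obtains \<mu> where "\<mu> \<in> borel_probs" "transport_cost N \<mu> \<le> ennreal (D + \<epsilon>)"
    and "(\<Sum>z\<in>Z. \<bar>(\<integral>x. \<phi> z x \<partial>\<mu>) - (\<integral>x. \<phi> z x \<partial>\<rho>)\<bar>) \<le> \<epsilon>"
proof -
  have sets: "sets \<rho> = sets borel" using \<rho> by (simp add: borel_subprobs_def)
  interpret R: finite_measure \<rho> using \<rho> by (rule finite_measure_borel_subprob)
  have sp: "space \<rho> = UNIV" using sets_eq_imp_space_eq[OF sets] by simp
  have \<phi>m: "\<phi> z \<in> borel_measurable borel" for z
    using \<phi>(1) by (rule borel_measurable_continuous_onI)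
  have \<phi>i: "integrable \<rho> (\<phi> z)" for z
    using \<phi>m \<phi>(2) by (intro R.integrable_const_bound[where B=1]) (auto simp: measurable_cong_sets[OF sets refl])
  define f where "f = (\<lambda>z x. 1 / real N * (\<Sum>i<N. \<phi> z (x i)))"
  \<comment> \<open>A sum of squares at most \<open>\<eta>\<^sup>2\<close> bounds each error by
    \<open>\<eta>\<close>, and \<open>card Z\<close> of them add up to at most
    \<open>\<epsilon>\<close>; the \<open>1\<close> covers an empty \<open>Z\<close>.\<close>
  define \<eta> where "\<eta> = \<epsilon> / (real (card Z) + 1)"
  have \<eta>: "\<eta> > 0" using \<epsilon> by (simp add: \<eta>_def add_nonneg_pos)
  have f1: "\<bar>f z x\<bar> \<le> 1" for z and x :: "nat \<Rightarrow> 'a"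
  proof -
    have "\<bar>\<Sum>i<N. \<phi> z (x i)\<bar> \<le> (\<Sum>i<N. \<bar>\<phi> z (x i)\<bar>)" by (rule sum_abs)
    also have "\<dots> \<le> real N * 1" using sum_bounded_above[of "{..<N}" "\<lambda>i. \<bar>\<phi> z (x i)\<bar>" 1] \<phi>(2) by simp
    finally show ?thesis using N by (simp add: f_def abs_mult)
  qed
  have "min \<epsilon> (\<eta>\<^sup>2) > 0" using \<epsilon> \<eta> by simp
  then obtain p where p: "(\<integral>\<^sup>+x. coulomb N x \<partial>measure_pmf p) \<le> ennreal (D + min \<epsilon> (\<eta>\<^sup>2))"
    "(\<Sum>z\<in>Z. ((\<integral>x. f z x \<partial>measure_pmf p) - (\<integral>x. \<phi> z x \<partial>\<rho>))\<^sup>2) \<le> min \<epsilon> (\<eta>\<^sup>2)"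
  proof (rule near_optimal_pmf_of_dual_bound[OF Z f1, rotated])
    fix \<alpha> b assume le: "\<And>x. ennreal (\<alpha> + (\<Sum>z\<in>Z. b z * f z x)) \<le> coulomb N x"
    define u where "u = (\<lambda>a. \<alpha> + (\<Sum>z\<in>Z. b z * (case a of Some x \<Rightarrow> \<phi> z x | None \<Rightarrow> 0)))"
    have far: "u (Some y) = u None" if "S \<le> norm y" for y
      using supp[OF _ that] by (simp add: u_def)
    have cu: "continuous_map onept euclideanreal u"
    proof (rule continuous_map_onept)
      show "continuous_on UNIV (\<lambda>x. u (Some x))"
        unfolding u_def using \<phi>(1) by (auto intro!: continuous_intros)
      show "((\<lambda>x. u (Some x)) \<longlongrightarrow> u None) at_infinity"
        using far by (rule tendsto_at_infinity_if_zero_outside)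
    qed
    have "ennreal (1 / real N * (\<Sum>i<N. u (Some (x i)))) \<le> coulomb N x" for x
    proof -
      have "(\<Sum>i<N. u (Some (x i))) = real N * \<alpha> + (\<Sum>i<N. \<Sum>z\<in>Z. b z * \<phi> z (x i))"
        unfolding u_def by (simp add: sum.distrib)
      also have "(\<Sum>i<N. \<Sum>z\<in>Z. b z * \<phi> z (x i)) = (\<Sum>z\<in>Z. b z * (\<Sum>i<N. \<phi> z (x i)))"
        unfolding sum_distrib_left by (rule sum.swap)
      also have "\<dots> = real N * (\<Sum>z\<in>Z. b z * f z x)"
        using N unfolding sum_distrib_left by (intro sum.cong refl) (simp add: f_def sum_distrib_left)
      finally have "1 / real N * (\<Sum>i<N. u (Some (x i))) = \<alpha> + (\<Sum>z\<in>Z. b z * f z x)"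
        using N by (simp add: distrib_left[symmetric])
      then show ?thesis using le[of x] by simp
    qed
    then have "(\<integral>a. u a \<partial>onept_extension \<rho>) \<le> D"
      using far by (intro dual[OF cu] onept_coulomb_ge_of_coulomb_ge)
    moreover obtain B where "\<And>a. \<bar>u a\<bar> \<le> B"
      using continuous_map_onept_bounded[OF cu] by blast
    then have "(\<integral>a. u a \<partial>onept_extension \<rho>) = (\<integral>x. u (Some x) \<partial>\<rho>) + (1 - measure \<rho> UNIV) * u None"
      using borel_measurable_lower_semicontinuous_map[OF continuous_imp_lower_semicontinuous_map[OF cu]]
      by (intro integral_onept_extension[OF \<rho>])
    \<comment> \<open>At \<open>None\<close> the test functions contribute zero and \<open>u\<close>
      equals \<open>\<alpha>\<close>, so the atom restores the full weight of
      \<open>\<alpha>\<close> in the dual value.\<close>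
    moreover have "(\<integral>x. u (Some x) \<partial>\<rho>) = measure \<rho> UNIV * \<alpha> + (\<Sum>z\<in>Z. b z * (\<integral>x. \<phi> z x \<partial>\<rho>))"
      unfolding u_def using \<phi>i by (simp add: sp)
    ultimately show "\<alpha> + (\<Sum>z\<in>Z. b z * (\<integral>x. \<phi> z x \<partial>\<rho>)) \<le> D"
      by (simp add: u_def algebra_simps)
  qed auto
  obtain \<mu> where \<mu>: "\<mu> \<in> borel_probs" "transport_cost N \<mu> \<le> (\<integral>\<^sup>+x. coulomb N x \<partial>measure_pmf p)"
    "\<And>g B. g \<in> borel_measurable borel \<Longrightarrow> (\<And>z. \<bar>g z\<bar> \<le> B) \<Longrightarrow>
           (\<integral>z. g z \<partial>\<mu>) = (\<integral>x. 1 / real N * (\<Sum>i<N. g (x i)) \<partial>measure_pmf p)"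
    using symmetrised_pmf[OF N, of p] by blast
  have eq: "(\<integral>x. \<phi> z x \<partial>\<mu>) = (\<integral>x. f z x \<partial>measure_pmf p)" for z
    unfolding f_def by (rule \<mu>(3)[OF \<phi>m \<phi>(2)])
  have "\<bar>(\<integral>x. \<phi> z x \<partial>\<mu>) - (\<integral>x. \<phi> z x \<partial>\<rho>)\<bar> \<le> \<eta>" if "z \<in> Z" for z
  proof -
    have "((\<integral>x. f z x \<partial>measure_pmf p) - (\<integral>x. \<phi> z x \<partial>\<rho>))\<^sup>2 \<le> \<eta>\<^sup>2"
      using member_le_sum[OF that, of "\<lambda>z. ((\<integral>x. f z x \<partial>measure_pmf p) - (\<integral>x. \<phi> z x \<partial>\<rho>))\<^sup>2"] Z p(2)
      by simp
    then show ?thesis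
      using \<eta> abs_le_square_iff[of "(\<integral>x. f z x \<partial>measure_pmf p) - (\<integral>x. \<phi> z x \<partial>\<rho>)" \<eta>] by (simp add: eq)
  qed
  from sum_bounded_above[OF this]
  have "(\<Sum>z\<in>Z. \<bar>(\<integral>x. \<phi> z x \<partial>\<mu>) - (\<integral>x. \<phi> z x \<partial>\<rho>)\<bar>) \<le> real (card Z) * \<eta>" .
  also have "\<dots> \<le> (real (card Z) + 1) * \<eta>" using \<eta> by (intro mult_right_mono) auto
  also have "\<dots> = \<epsilon>" by (simp add: \<eta>_def add_pos_nonneg)
  finally have sum: "(\<Sum>z\<in>Z. \<bar>(\<integral>x. \<phi> z x \<partial>\<mu>) - (\<integral>x. \<phi> z x \<partial>\<rho>)\<bar>) \<le> \<epsilon>" .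
  have "transport_cost N \<mu> \<le> ennreal (D + min \<epsilon> (\<eta>\<^sup>2))" using \<mu>(2) p(1) by (rule order_trans)
  also have "\<dots> \<le> ennreal (D + \<epsilon>)" by (intro ennreal_leI) simp
  finally show thesis using \<mu>(1) sum by (intro that)
qed

text \<open>The combination \<open>s\<close> is uniformly within \<open>2 * \<epsilon>\<close> of
  \<open>g\<close>: one \<open>\<epsilon>\<close> for the oscillation, one for the region beyond
  radius \<open>R\<close>, where the partition may sum to less than \<open>1\<close>. Both measures
  have mass at most \<open>1\<close>, hence \<open>4 * \<epsilon>\<close>; on \<open>s\<close> the
  integrals differ by at most \<open>F * \<eta>\<close>.\<close>

lemma abs_integral_diff_le_of_partition:
  fixes g :: "'a::euclidean_space \<Rightarrow> real"
  assumes \<mu>: "\<mu> \<in> borel_subprobs" and \<rho>: "\<rho> \<in> borel_subprobs"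
    and g: "g \<in> borel_measurable borel" "\<And>x. \<bar>g x\<bar> \<le> F"
    and Z: "finite Z" and \<phi>: "\<And>z. \<phi> z \<in> borel_measurable borel" "\<And>z x. 0 \<le> \<phi> z x"
    and le1: "\<And>x. (\<Sum>z\<in>Z. \<phi> z x) \<le> 1" and eq1: "\<And>x. norm x \<le> R \<Longrightarrow> (\<Sum>z\<in>Z. \<phi> z x) = 1"
    and loc: "\<And>z x. \<delta> \<le> dist x z \<Longrightarrow> \<phi> z x = 0"
    and osc: "\<And>x z. dist x z < \<delta> \<Longrightarrow> \<bar>g x - g z\<bar> \<le> \<epsilon>" and small: "\<And>x. R < norm x \<Longrightarrow> \<bar>g x\<bar> \<le> \<epsilon>"
    and \<epsilon>: "0 \<le> \<epsilon>"
    and sum: "(\<Sum>z\<in>Z. \<bar>(\<integral>x. \<phi> z x \<partial>\<mu>) - (\<integral>x. \<phi> z x \<partial>\<rho>)\<bar>) \<le> \<eta>"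
  shows "\<bar>(\<integral>x. g x \<partial>\<mu>) - (\<integral>x. g x \<partial>\<rho>)\<bar> \<le> 4 * \<epsilon> + F * \<eta>"
proof -
  define s where "s = (\<lambda>x. \<Sum>z\<in>Z. g z * \<phi> z x)"
  have F0: "0 \<le> F" using g(2)[of 0] by linarith
  have near: "\<bar>g x - s x\<bar> \<le> 2 * \<epsilon>" for x
  proof -
    have "g x - s x = g x * (1 - (\<Sum>z\<in>Z. \<phi> z x)) + (\<Sum>z\<in>Z. \<phi> z x * (g x - g z))"
      by (simp add: s_def right_diff_distrib sum_subtractf sum_distrib_left mult.commute)
    then have "\<bar>g x - s x\<bar> \<le> \<bar>g x * (1 - (\<Sum>z\<in>Z. \<phi> z x))\<bar> + (\<Sum>z\<in>Z. \<bar>\<phi> z x * (g x - g z)\<bar>)"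
      using sum_abs[of "\<lambda>z. \<phi> z x * (g x - g z)" Z] by linarith
    also have "\<bar>g x * (1 - (\<Sum>z\<in>Z. \<phi> z x))\<bar> \<le> \<epsilon>"
    proof (cases "norm x \<le> R")
      case False
      have "0 \<le> (\<Sum>z\<in>Z. \<phi> z x)" using \<phi>(2) by (intro sum_nonneg)
      then have "\<bar>1 - (\<Sum>z\<in>Z. \<phi> z x)\<bar> \<le> 1" using le1[of x] by linarith
      then have "\<bar>g x\<bar> * \<bar>1 - (\<Sum>z\<in>Z. \<phi> z x)\<bar> \<le> \<epsilon> * 1"
        using False small \<epsilon> by (intro mult_mono) auto
      then show ?thesis by (simp add: abs_mult)
    qed (use eq1 \<epsilon> in simp)
    also have "(\<Sum>z\<in>Z. \<bar>\<phi> z x * (g x - g z)\<bar>) \<le> (\<Sum>z\<in>Z. \<phi> z x * \<epsilon>)"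
    proof (rule sum_mono)
      fix z
      show "\<bar>\<phi> z x * (g x - g z)\<bar> \<le> \<phi> z x * \<epsilon>"
      proof (cases "dist x z < \<delta>")
        case True
        then show ?thesis using osc \<phi>(2)[of z x] by (simp add: abs_mult mult_left_mono)
      qed (use loc[of x z] in simp)
    qed
    also have "\<dots> \<le> 1 * \<epsilon>"
      unfolding sum_distrib_right[symmetric] using le1 \<epsilon> by (rule mult_right_mono)
    finally show ?thesis by simp
  qed
  have \<phi>1: "\<bar>\<phi> z x\<bar> \<le> 1" if "z \<in> Z" for z x
    using member_le_sum[OF that, of "\<lambda>z. \<phi> z x"] Z \<phi>(2)[of _ x] le1[of x] by simp
  have close: "\<bar>(\<integral>x. g x \<partial>\<nu>) - (\<Sum>z\<in>Z. g z * (\<integral>x. \<phi> z x \<partial>\<nu>))\<bar> \<le> 2 * \<epsilon>"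
    if \<nu>: "\<nu> \<in> borel_subprobs" for \<nu>
  proof -
    have sets: "sets \<nu> = sets borel" and mass: "emeasure \<nu> UNIV \<le> 1"
      using \<nu> by (auto simp: borel_subprobs_def)
    interpret finite_measure \<nu> using \<nu> by (rule finite_measure_borel_subprob)
    have sp: "space \<nu> = UNIV" using sets_eq_imp_space_eq[OF sets] by simp
    have m1: "measure \<nu> UNIV \<le> 1" using mass by (simp add: emeasure_eq_measure)
    have i\<phi>: "integrable \<nu> (\<phi> z)" if "z \<in> Z" for z
      using \<phi>(1) \<phi>1[OF that]
      by (intro integrable_const_bound[where B=1]) (auto simp: measurable_cong_sets[OF sets refl])
    have ig: "integrable \<nu> g"
      using g by (intro integrable_const_bound[where B=F]) (auto simp: measurable_cong_sets[OF sets refl])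
    have i_s: "integrable \<nu> s"
      unfolding s_def using i\<phi> by (intro Bochner_Integration.integrable_sum) auto
    have "(\<integral>x. s x \<partial>\<nu>) = (\<Sum>z\<in>Z. \<integral>x. g z * \<phi> z x \<partial>\<nu>)"
      unfolding s_def using i\<phi> by (intro Bochner_Integration.integral_sum) auto
    then have "(\<integral>x. g x \<partial>\<nu>) - (\<Sum>z\<in>Z. g z * (\<integral>x. \<phi> z x \<partial>\<nu>)) = (\<integral>x. g x - s x \<partial>\<nu>)"
      using ig i_s by simp
    also have "\<bar>\<dots>\<bar> \<le> (\<integral>x. \<bar>g x - s x\<bar> \<partial>\<nu>)"
      by (rule integral_abs_bound)
    also have "\<dots> \<le> (\<integral>x. 2 * \<epsilon> \<partial>\<nu>)"
      using ig i_s near by (intro integral_mono) auto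
    also have "\<dots> = measure \<nu> UNIV * (2 * \<epsilon>)"
      by (simp add: sp)
    also have "\<dots> \<le> 1 * (2 * \<epsilon>)"
      using m1 \<epsilon> by (intro mult_right_mono) auto
    finally show ?thesis by simp
  qed
  have "\<bar>(\<Sum>z\<in>Z. g z * (\<integral>x. \<phi> z x \<partial>\<mu>)) - (\<Sum>z\<in>Z. g z * (\<integral>x. \<phi> z x \<partial>\<rho>))\<bar>
      = \<bar>\<Sum>z\<in>Z. g z * ((\<integral>x. \<phi> z x \<partial>\<mu>) - (\<integral>x. \<phi> z x \<partial>\<rho>))\<bar>"
    by (simp add: sum_subtractf right_diff_distrib)
  also have "\<dots> \<le> (\<Sum>z\<in>Z. \<bar>g z * ((\<integral>x. \<phi> z x \<partial>\<mu>) - (\<integral>x. \<phi> z x \<partial>\<rho>))\<bar>)"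
    by (rule sum_abs)
  also have "\<dots> \<le> (\<Sum>z\<in>Z. F * \<bar>(\<integral>x. \<phi> z x \<partial>\<mu>) - (\<integral>x. \<phi> z x \<partial>\<rho>)\<bar>)"
    unfolding abs_mult by (intro sum_mono mult_right_mono g(2)) auto
  also have "\<dots> \<le> F * \<eta>"
    unfolding sum_distrib_left[symmetric] using sum F0 by (rule mult_left_mono)
  finally show ?thesis using close[OF \<mu>] close[OF \<rho>] by linarith
qed

lemma uniformly_small_oscillation:
  fixes g :: "'a::euclidean_space \<Rightarrow> real"
  assumes cont: "continuous_on UNIV g" and lim: "(g \<longlongrightarrow> 0) at_infinity" and "\<epsilon> > 0"
  obtains n0 where "\<And>n x z. n \<ge> n0 \<Longrightarrow> dist x z < 1 / real (Suc n) \<Longrightarrow> \<bar>g x - g z\<bar> \<le> \<epsilon>"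
    and "\<And>n x. n \<ge> n0 \<Longrightarrow> real n < norm x \<Longrightarrow> \<bar>g x\<bar> \<le> \<epsilon>"
proof -
  have "\<forall>\<^sub>F x in at_infinity. dist (g x) 0 < \<epsilon> / 2"
    using lim \<open>\<epsilon> > 0\<close> by (intro tendstoD) auto
  then obtain r where r: "\<And>x. r \<le> norm x \<Longrightarrow> \<bar>g x\<bar> < \<epsilon> / 2"
    unfolding eventually_at_infinity by auto
  \<comment> \<open>The extra \<open>1\<close> handles pairs across the boundary: at distance below
    \<open>1\<close>, either both points lie in this ball or both have norm at least
    \<open>r\<close>, where \<open>g\<close> is small.\<close>
  have "uniformly_continuous_on (cball 0 (r + 1)) g"
    using cont by (intro compact_uniformly_continuous continuous_on_subset[OF cont]) auto
  then obtain d where d: "d > 0"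
    "\<And>x z. x \<in> cball 0 (r + 1) \<Longrightarrow> z \<in> cball 0 (r + 1) \<Longrightarrow> dist z x < d \<Longrightarrow> dist (g z) (g x) < \<epsilon>"
    unfolding uniformly_continuous_on_def using \<open>\<epsilon> > 0\<close> by metis
  obtain n1 :: nat where n1: "r < real n1" using reals_Archimedean2 by blast
  obtain n2 :: nat where n2: "inverse (real (Suc n2)) < d" using reals_Archimedean[OF d(1)] by blast
  show thesis
  proof (rule that[of "max n1 n2"])
    fix n and x z :: 'a assume n: "max n1 n2 \<le> n" and xz: "dist x z < 1 / real (Suc n)"
    have "1 / real (Suc n) \<le> 1 / real (Suc n2)"
      using n by (intro divide_left_mono) auto
    then have "dist x z < d" using xz n2 by (simp add: inverse_eq_divide)
    have "1 / real (Suc n) \<le> 1" by simp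
    with xz have le1: "dist x z < 1" by linarith
    show "\<bar>g x - g z\<bar> \<le> \<epsilon>"
    proof (cases "x \<in> cball 0 (r + 1) \<and> z \<in> cball 0 (r + 1)")
      case True
      then have "dist (g x) (g z) < \<epsilon>"
        using d(2)[of z x] \<open>dist x z < d\<close> by blast
      then show ?thesis by (simp add: dist_real_def)
    next
      case False
      then have "r + 1 < norm x \<or> r + 1 < norm z" by auto
      then have "r \<le> norm x" "r \<le> norm z"
        using norm_triangle_ineq2[of x z] norm_triangle_ineq2[of z x] le1
        by (auto simp: dist_norm norm_minus_commute)
      with r[of x] r[of z] show ?thesis by linarith
    qed
  next
    fix n and x :: 'a assume "max n1 n2 \<le> n" "real n < norm x"
    moreover from this have "real n1 \<le> real n" by simp
    ultimately have "r \<le> norm x" using n1 by linarith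
    with r[of x] \<open>\<epsilon> > 0\<close> show "\<bar>g x\<bar> \<le> \<epsilon>" by linarith
  qed
qed

lemma relaxed_cost_le_of_dual_bound:
  fixes \<rho> :: "'a::euclidean_space measure"
  assumes N: "N > 0" and \<rho>: "\<rho> \<in> borel_subprobs"
    and dual: "\<And>u. continuous_map onept euclideanreal u \<Longrightarrow>
        (\<And>x. ennreal (1 / real N * (\<Sum>i<N. u (x i))) \<le> onept_coulomb N x) \<Longrightarrow>
        (\<integral>a. u a \<partial>onept_extension \<rho>) \<le> D"
  shows "relaxed_cost N \<rho> \<le> ennreal D"
proof -
  \<comment> \<open>\<open>Q\<close> records what the comparison of integrals needs; the partition
    stays existentially bound, so the choice over \<open>n\<close> selects only the
    measures.\<close>
  define Q where "Q = (\<lambda>n \<mu> Z \<phi>. finite Z \<and> (\<forall>z. continuous_on UNIV (\<phi> z)) \<and> (\<forall>z x. 0 \<le> \<phi> z x)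
      \<and> (\<forall>x. (\<Sum>z\<in>Z. \<phi> z x) \<le> 1) \<and> (\<forall>x. norm x \<le> real n \<longrightarrow> (\<Sum>z\<in>Z. \<phi> z x) = 1)
      \<and> (\<forall>z x. 1 / real (Suc n) \<le> dist x z \<longrightarrow> \<phi> z x = 0)
      \<and> (\<Sum>z\<in>Z. \<bar>(\<integral>x. \<phi> z x \<partial>\<mu>) - (\<integral>x. \<phi> z x \<partial>\<rho>)\<bar>) \<le> 1 / real (Suc n))"
  have "\<forall>n. \<exists>\<mu>. \<mu> \<in> borel_probs \<and> transport_cost N \<mu> \<le> ennreal (D + 1 / real (Suc n))
      \<and> (\<exists>Z (\<phi> :: 'a \<Rightarrow> 'a \<Rightarrow> real). Q n \<mu> Z \<phi>)"
  proof
    fix n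
    have pos: "1 / real (Suc n) > 0" by simp
    obtain Z :: "'a set" and \<phi> :: "'a \<Rightarrow> 'a \<Rightarrow> real" where Z: "finite Z"
      and \<phi>: "\<And>z. continuous_on UNIV (\<phi> z)" "\<And>z x. 0 \<le> \<phi> z x"
      and le1: "\<And>x. (\<Sum>z\<in>Z. \<phi> z x) \<le> 1" and eq1: "\<And>x. norm x \<le> real n \<Longrightarrow> (\<Sum>z\<in>Z. \<phi> z x) = 1"
      and loc: "\<And>z x. 1 / real (Suc n) \<le> dist x z \<Longrightarrow> \<phi> z x = 0"
      by (rule exists_partition_of_unity_cball[OF pos, where R = "real n"]) (rule that)
    \<comment> \<open>The partition bounds \<open>\<phi> z\<close> by \<open>1\<close> for centres
      in \<open>Z\<close>; extension by zero gives the bound at every index.\<close>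
    define \<phi>' where "\<phi>' = (\<lambda>z. if z \<in> Z then \<phi> z else (\<lambda>_. 0))"
    have c: "continuous_on UNIV (\<phi>' z)" for z using \<phi>(1) by (simp add: \<phi>'_def)
    have b: "\<bar>\<phi>' z x\<bar> \<le> 1" for z x
      using member_le_sum[of z Z "\<lambda>z. \<phi> z x"] Z \<phi>(2) order_trans[OF _ le1[of x]]
      by (auto simp: \<phi>'_def)
    \<comment> \<open>Every \<open>\<phi> z\<close> vanishes at distance \<open>1\<close> or more
      from its centre, so beyond norm \<open>S\<close> those with centre in \<open>Z\<close> all
      vanish.\<close>
    define S where "S = (\<Sum>z\<in>Z. norm z) + 1"
    have supp: "\<phi>' z x = 0" if "z \<in> Z" "S \<le> norm x" for z x
    proof -
      have "norm z \<le> (\<Sum>z\<in>Z. norm z)"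
        by (rule member_le_sum) (use that Z in auto)
      with that(2) norm_triangle_ineq2[of x z] have "1 \<le> dist x z"
        by (simp add: S_def dist_norm)
      moreover have "1 / real (Suc n) \<le> 1" by simp
      ultimately have "1 / real (Suc n) \<le> dist x z" by linarith
      then show ?thesis using loc by (simp add: \<phi>'_def)
    qed
    obtain \<mu> where \<mu>: "\<mu> \<in> borel_probs" "transport_cost N \<mu> \<le> ennreal (D + 1 / real (Suc n))"
      "(\<Sum>z\<in>Z. \<bar>(\<integral>x. \<phi>' z x \<partial>\<mu>) - (\<integral>x. \<phi>' z x \<partial>\<rho>)\<bar>) \<le> 1 / real (Suc n)"
      by (rule near_optimal_marginal[OF N \<rho> dual Z c b supp pos])
    have "Q n \<mu> Z \<phi>"
      unfolding Q_def using Z \<phi> le1 eq1 loc \<mu>(3) by (simp add: \<phi>'_def cong: sum.cong)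
    with \<mu>(1,2) show "\<exists>\<mu>. \<mu> \<in> borel_probs \<and> transport_cost N \<mu> \<le> ennreal (D + 1 / real (Suc n))
      \<and> (\<exists>Z (\<phi> :: 'a \<Rightarrow> 'a \<Rightarrow> real). Q n \<mu> Z \<phi>)" by blast
  qed
  from choice[OF this] obtain \<rho>s where \<rho>s: "\<And>n. \<rho>s n \<in> borel_probs"
    and cost: "\<And>n. transport_cost N (\<rho>s n) \<le> ennreal (D + 1 / real (Suc n))"
    and Q: "\<And>n. \<exists>Z (\<phi> :: 'a \<Rightarrow> 'a \<Rightarrow> real). Q n (\<rho>s n) Z \<phi>"
    by blast
  have "weak_star_conv \<rho>s \<rho>"
    unfolding weak_star_conv_def
  proof (intro allI impI)
    fix g :: "'a \<Rightarrow> real" assume g: "continuous_on UNIV g \<and> (g \<longlongrightarrow> 0) at_infinity"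
    have "continuous_map onept euclideanreal (\<lambda>a. case a of Some x \<Rightarrow> g x | None \<Rightarrow> 0)"
      using g by (intro continuous_map_onept) auto
    then obtain F where "\<And>a. \<bar>case a of Some x \<Rightarrow> g x | None \<Rightarrow> 0\<bar> \<le> F"
      using continuous_map_onept_bounded by blast
    from this[of "Some _"] have F: "\<bar>g x\<bar> \<le> F" for x by simp
    have gm: "g \<in> borel_measurable borel"
      using g by (intro borel_measurable_continuous_onI) auto
    have bound: "\<forall>\<^sub>F n in sequentially. \<bar>(\<integral>x. g x \<partial>\<rho>s n) - (\<integral>x. g x \<partial>\<rho>)\<bar> \<le> 4 * \<epsilon> + F * (1 / real (Suc n))"
      if \<epsilon>: "\<epsilon> > 0" for \<epsilon>
    proof -
      obtain n0 where n0: "\<And>n x z. n \<ge> n0 \<Longrightarrow> dist x z < 1 / real (Suc n) \<Longrightarrow> \<bar>g x - g z\<bar> \<le> \<epsilon>"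
        "\<And>n x. n \<ge> n0 \<Longrightarrow> real n < norm x \<Longrightarrow> \<bar>g x\<bar> \<le> \<epsilon>"
        using uniformly_small_oscillation[of g \<epsilon>] g \<epsilon> by blast
      have "\<bar>(\<integral>x. g x \<partial>\<rho>s n) - (\<integral>x. g x \<partial>\<rho>)\<bar> \<le> 4 * \<epsilon> + F * (1 / real (Suc n))" if n: "n \<ge> n0" for n
      proof -
        obtain Z and \<phi> :: "'a \<Rightarrow> 'a \<Rightarrow> real" where Q: "Q n (\<rho>s n) Z \<phi>" using Q by blast
        have sub: "\<rho>s n \<in> borel_subprobs"
          using \<rho>s[of n] by (rule borel_probs_imp_subprobs)
        show ?thesis
        proof (rule abs_integral_diff_le_of_partition[OF sub \<rho> gm F, where Z = Z and \<phi> = \<phi> and R = "real n" and \<delta> = "1 / real (Suc n)"])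
          show "\<phi> z \<in> borel_measurable borel" for z
            using Q by (auto simp: Q_def intro: borel_measurable_continuous_onI)
        qed (use Q n0 n \<epsilon> in \<open>auto simp: Q_def\<close>)
      qed
      then show ?thesis unfolding eventually_sequentially by blast
    qed
    show "(\<lambda>n. \<integral>x. g x \<partial>\<rho>s n) \<longlonglongrightarrow> (\<integral>x. g x \<partial>\<rho>)"
    proof (rule tendstoI)
      fix e :: real assume e: "e > 0"
      have "(\<lambda>n. F * (1 / real (Suc n))) \<longlonglongrightarrow> 0"
        using tendsto_mult_right_zero[OF LIMSEQ_inverse_real_of_nat, of F] by (simp add: inverse_eq_divide)
      then have "\<forall>\<^sub>F n in sequentially. F * (1 / real (Suc n)) < e / 2"
        using e by (intro order_tendstoD) auto
      moreover have "\<forall>\<^sub>F n in sequentially. \<bar>(\<integral>x. g x \<partial>\<rho>s n) - (\<integral>x. g x \<partial>\<rho>)\<bar> \<le> 4 * (e / 16) + F * (1 / real (Suc n))"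
        using e by (intro bound) auto
      ultimately show "\<forall>\<^sub>F n in sequentially. dist (\<integral>x. g x \<partial>\<rho>s n) (\<integral>x. g x \<partial>\<rho>) < e"
      proof eventually_elim
        case (elim n)
        then show ?case using e unfolding dist_real_def by linarith
      qed
    qed
  qed
  then have "relaxed_cost N \<rho> \<le> liminf (\<lambda>n. transport_cost N (\<rho>s n))"
    unfolding relaxed_cost_def using \<rho>s by (intro Inf_lower) blast
  also have "\<dots> \<le> liminf (\<lambda>n. ennreal (D + 1 / real (Suc n)))"
    by (intro Liminf_mono always_eventually allI cost)
  also have "\<dots> = ennreal D"
  proof (rule lim_imp_Liminf)
    have "(\<lambda>n. D + 1 / real (Suc n)) \<longlonglongrightarrow> D + 0"
      using tendsto_add[OF tendsto_const LIMSEQ_inverse_real_of_nat] by (simp add: inverse_eq_divide)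
    then show "(\<lambda>n. ennreal (D + 1 / real (Suc n))) \<longlonglongrightarrow> ennreal D"
      using tendsto_ennrealI by simp
  qed simp
  finally show ?thesis .
qed

section \<open>Equality of the relaxed cost with both suprema\<close>

theorem proposition3p8:
  fixes \<rho> :: "(real ^ 'd) measure" and N :: nat
  assumes "N \<ge> 2"
    and "\<rho> \<in> borel_subprobs"
  shows "enn2ereal (relaxed_cost N \<rho>) =
           Sup {ext_integral (onept_extension \<rho>) u | u.
                  lower_semicontinuous_map onept u \<and> dual_admissible N \<rho> u} \<and>
         enn2ereal (relaxed_cost N \<rho>) =
           Sup {ext_integral (onept_extension \<rho>) u | u.
                  continuous_map onept euclideanreal u \<and> dual_admissible N \<rho> u}"
proof -
  have N: "N > 0" and \<rho>: "\<rho> \<in> borel_subprobs" using assms by auto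
  let ?L = "enn2ereal (relaxed_cost N \<rho>)"
  let ?S = "{ext_integral (onept_extension \<rho>) u | u.
      lower_semicontinuous_map onept u \<and> dual_admissible N \<rho> u}"
  let ?C = "{ext_integral (onept_extension \<rho>) u | u.
      continuous_map onept euclideanreal u \<and> dual_admissible N \<rho> u}"
  \<comment> \<open>The upper bound asks only about functions admissible everywhere; these are
    admissible almost everywhere and bounded, so their extended integral is the Bochner one.\<close>
  have C: "ereal (\<integral>a. u a \<partial>onept_extension \<rho>) \<le> Sup ?C"
    if u: "continuous_map onept euclideanreal u"
      and le: "\<And>x. ennreal (1 / real N * (\<Sum>i<N. u (x i))) \<le> onept_coulomb N x" for u
  proof (rule Sup_upper)
    obtain B where B: "\<And>a. \<bar>u a\<bar> \<le> B"
      using continuous_map_onept_bounded[OF u] by blast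
    have "integrable (onept_extension \<rho>) u"
      using borel_measurable_lower_semicontinuous_map[OF continuous_imp_lower_semicontinuous_map[OF u]] B
      by (rule integrable_onept_extension[OF \<rho>])
    moreover have "dual_admissible N \<rho> u"
      unfolding dual_admissible_def ereal_le_enn2ereal_iff using le by (intro AE_I2)
    ultimately show "ereal (\<integral>a. u a \<partial>onept_extension \<rho>) \<in> ?C"
      using u ext_integral_eq_lebesgue_integral[of "onept_extension \<rho>" u] by force
  qed
  \<comment> \<open>The zero function is admissible, so the supremum is at least \<open>0\<close>:
    this excludes \<open>MInf\<close> and lets \<open>D\<close> be recovered from
    \<open>ennreal D\<close>.\<close>
  have "?L \<le> Sup ?C"
  proof (cases "Sup ?C")
    case (real D)
    have "relaxed_cost N \<rho> \<le> ennreal D"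
    proof (rule relaxed_cost_le_of_dual_bound[OF N \<rho>])
      fix u :: "(real ^ 'd) option \<Rightarrow> real"
      assume "continuous_map onept euclideanreal u"
        "\<And>x. ennreal (1 / real N * (\<Sum>i<N. u (x i))) \<le> onept_coulomb N x"
      from C[OF this] show "(\<integral>a. u a \<partial>onept_extension \<rho>) \<le> D"
        unfolding real by simp
    qed
    moreover have "0 \<le> D"
      using C[of "\<lambda>_. 0"] real by simp
    ultimately show ?thesis
      unfolding real less_eq_ennreal.rep_eq by (simp add: enn2ereal_ennreal)
  next
    case MInf
    then show ?thesis using C[of "\<lambda>_. 0"] by simp
  qed simp
  moreover have "Sup ?C \<le> Sup ?S"
    using continuous_imp_lower_semicontinuous_map by (intro Sup_subset_mono) blast
  moreover have "Sup ?S \<le> ?L"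
    using relaxed_cost_ge_lower_semicontinuous[OF N \<rho>] by (intro Sup_least) blast
  ultimately show ?thesis by (meson order.antisym order.trans)
qed

end
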